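(* The number of unit-volume tetrahedra determined by $n$ points in $\mathbb{R}^3$ is $O(n^{7/2})$.
   Context: A tetrahedron determined by a finite set $S\subset\mathbb{R}^3$ is a tetrahedron whose four vertices are points of $S$. It is unit-volume if its volume is $1$. The constant hidden in $O(\cdot)$ is absolute (independent of $n$ and of the point set). *)

theory Defs
  imports "HOL-Analysis.Analysis"
begin

definition unit_volume_tetrahedra :: "(real ^ 3) set \<Rightarrow> (real ^ 3) set set" where
  "unit_volume_tetrahedra S =
     {T. 3 simplex T \<and> {x. x extreme_point_of T} \<subseteq> S \<and> measure lborel T = 1}"

text \<open>Since \<^const>\<open>card\<close> of an infinite set is 0, the following fact is what makes
  counting these tetrahedra meaningful.\<close>

lemma finite_unit_volume_tetrahedra:
  assumes "finite S"
  shows "finite (unit_volume_tetrahedra S)"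
proof (rule finite_subset)
  show "unit_volume_tetrahedra S \<subseteq> (\<lambda>V. convex hull V) ` Pow S"
  proof
    fix T assume "T \<in> unit_volume_tetrahedra S"
    then obtain C where C: "\<not> affine_dependent C" "T = convex hull C"
        and sub: "{x. x extreme_point_of T} \<subseteq> S"
      unfolding unit_volume_tetrahedra_def simplex_def by auto
    have "C \<subseteq> S"
      using C sub extreme_point_of_convex_hull_affine_independent[OF C(1)] by auto
    then show "T \<in> (\<lambda>V. convex hull V) ` Pow S"
      using C(2) by blast
  qed
  show "finite ((\<lambda>V. convex hull V) ` Pow S)"
    using assms by simp
qed

end

theory Submission
  imports Defs
begin

text \<open>Let \<open>n\<close> be the number of points. Fix an edge \<open>pq\<close> and project along it. The pairs \<open>(r, s)\<close>
  completing \<open>pq\<close> to a tetrahedron of given signed volume form a graph without \<open>K\<^bsub>2,2\<^esub>\<close> on the projected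
  points, so there are \<open>O(n\<^bsup>3/2\<^esup>)\<close> of them unless many points project to the same place. To control
  these multiplicities let \<open>N(x)\<close> be the number of points on the line through \<open>x\<close> parallel to \<open>pq\<close>.

  If \<open>N(x) > \<surd>n\<close> for some \<open>x \<in> {p, r, s}\<close>, then \<open>p\<close>, \<open>r\<close>, \<open>s\<close> and the line through \<open>x\<close> determine
  \<open>q\<close>, and at most \<open>\<surd>n\<close> lines through \<open>x\<close> are that rich; this gives \<open>O(n\<^bsup>7/2\<^esup>)\<close> tuples. Otherwise the
  Cauchy-Schwarz inequality, applied to the pairs with \<open>N(s) \<le> N(r)\<close>, bounds the number of pairs by
  \<open>\<surd>n * (\<Sum>r. \<surd>N(r)) + n\<^bsup>3/2\<^esup>\<close>. Summed over \<open>p\<close>, \<open>q\<close>, the first term is at most \<open>3 n\<^bsup>3/2\<^esup>\<close> times the sum of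
  \<open>\<surd>N(p)\<close> over all pairs \<open>p \<noteq> q\<close> with \<open>N(p) \<le> \<surd>n\<close>. That sum is \<open>O(n\<^sup>2)\<close> by the Szemeredi-Trotter
  bound for lines with at least \<open>k\<close> points, applied to a generic projection to the plane. The latter
  bound follows from the crossing lemma for straight-line drawings.\<close>

section \<open>Straight-line drawings in the plane\<close>

text \<open>An edge is the pair of its endpoints, the left one first. The whole supporting line is
  evaluated, so two edges can be compared at any abscissa.\<close>

definition seg_y :: "(real \<times> real) \<times> (real \<times> real) \<Rightarrow> real \<Rightarrow> real" where
  "seg_y e x = snd (fst e) +
     (snd (snd e) - snd (fst e)) / (fst (snd e) - fst (fst e)) * (x - fst (fst e))"

definition over :: "(real \<times> real) \<times> (real \<times> real) \<Rightarrow> real \<Rightarrow> bool" where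
  "over e x \<longleftrightarrow> fst (fst e) < x \<and> x < fst (snd e)"

text \<open>Only interiors are compared, so a common endpoint is not a crossing. The relation is
  symmetric: counts of ordered pairs see each crossing twice.\<close>

definition crosses :: "(real \<times> real) \<times> (real \<times> real) \<Rightarrow> (real \<times> real) \<times> (real \<times> real) \<Rightarrow> bool" where
  "crosses e f \<longleftrightarrow> e \<noteq> f \<and> (\<exists>x. over e x \<and> over f x \<and> seg_y e x = seg_y f x)"

text \<open>As no vertex lies in the interior of an edge, two distinct edges on one line cannot
  overlap.\<close>

definition drawing :: "(real \<times> real) set \<Rightarrow> ((real \<times> real) \<times> (real \<times> real)) set \<Rightarrow> bool" where
  "drawing V E \<longleftrightarrow> finite V \<and> inj_on fst V \<and> E \<subseteq> V \<times> V \<and> (\<forall>e\<in>E. fst (fst e) < fst (snd e)) \<and>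
     (\<forall>e\<in>E. \<forall>v\<in>V. over e (fst v) \<longrightarrow> seg_y e (fst v) \<noteq> snd v)"

lemma seg_y_left [simp]: "seg_y e (fst (fst e)) = snd (fst e)"
  by (simp add: seg_y_def)

lemma seg_y_right [simp]: "fst (fst e) < fst (snd e) \<Longrightarrow> seg_y e (fst (snd e)) = snd (snd e)"
  by (simp add: seg_y_def)

section \<open>Order and intersection of supporting lines\<close>

lemma seg_y_diff_affine:
  "\<exists>m c. \<forall>x. seg_y e x - seg_y f x = m * x + c"
proof -
  define m where "m e = (snd (snd e) - snd (fst e)) / (fst (snd e) - fst (fst e))"
    for e :: "(real \<times> real) \<times> (real \<times> real)"
  have "seg_y e x - seg_y f x =
      (m e - m f) * x + (snd (fst e) - m e * fst (fst e) - (snd (fst f) - m f * fst (fst f)))" for x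
    by (simp add: seg_y_def m_def[symmetric] algebra_simps)
  then show ?thesis by blast
qed

lemma affine_sign_change:
  fixes m c :: real
  assumes "m * x1 + c < 0" "0 < m * x2 + c"
  shows "\<exists>x. (x1 < x \<and> x < x2 \<or> x2 < x \<and> x < x1) \<and> m * x + c = 0"
proof (cases "m > 0")
  case True
  with assms show ?thesis
    by (intro exI[of _ "- c / m"]) (auto simp: field_simps)
next
  case False
  have "m \<noteq> 0" using assms by auto
  with False have "m < 0" by simp
  with assms show ?thesis
    by (intro exI[of _ "- c / m"]) (auto simp: field_simps)
qed

lemma seg_y_sign_change:
  assumes "seg_y e x1 < seg_y f x1" "seg_y f x2 < seg_y e x2"
  shows "\<exists>x. (x1 < x \<and> x < x2 \<or> x2 < x \<and> x < x1) \<and> seg_y e x = seg_y f x"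
proof -
  obtain m c where mc: "\<And>x. seg_y e x - seg_y f x = m * x + c"
    using seg_y_diff_affine by metis
  have "m * x1 + c < 0" "0 < m * x2 + c"
    using assms mc[of x1] mc[of x2] by auto
  from affine_sign_change[OF this] show ?thesis
    by (metis mc eq_iff_diff_eq_0)
qed

lemma seg_y_between:
  assumes "seg_y e x0 = seg_y f x0" "seg_y e x1 < seg_y f x1" "x0 < x1 \<and> x0 < x \<or> x1 < x0 \<and> x < x0"
  shows "seg_y e x < seg_y f x"
proof -
  obtain m c where mc: "\<And>x. seg_y e x - seg_y f x = m * x + c"
    using seg_y_diff_affine by metis
  have 0: "m * x0 + c = 0" using mc[of x0] assms(1) by simp
  have 1: "m * (x1 - x0) < 0" using mc[of x1] assms(2) 0 by (simp add: algebra_simps)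
  have "m * (x - x0) < 0" using 1 assms(3) by (auto simp: mult_less_0_iff)
  then show ?thesis using mc[of x] 0 by (simp add: algebra_simps)
qed

lemma seg_y_eq_at_two:
  assumes "seg_y e x0 = seg_y f x0" "seg_y e x1 = seg_y f x1" "x0 \<noteq> x1"
  shows "seg_y e x = seg_y f x"
proof -
  obtain m c where mc: "\<And>x. seg_y e x - seg_y f x = m * x + c"
    using seg_y_diff_affine by metis
  have "m * x1 + c = 0" "m * x0 + c = 0" using mc[of x0] mc[of x1] assms by simp_all
  then have "m * x1 = m * x0" by linarith
  with assms(3) have "m = 0" by simp
  then show ?thesis using mc[of x] mc[of x0] assms(1) by simp
qed

text \<open>Edges that share their left endpoint and meet again lie on one line. If they differed,
  the nearer right endpoint would be a vertex inside the longer edge.\<close>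

lemma drawing_same_left:
  assumes D: "drawing V E" and e: "e \<in> E" "f \<in> E" and ab: "fst e = fst f"
    and x: "fst (fst e) < x" "seg_y e x = seg_y f x"
  shows "e = f"
proof (rule ccontr)
  assume ne: "e \<noteq> f"
  have "seg_y e (fst (fst e)) = seg_y f (fst (fst e))"
    using seg_y_left[of e] seg_y_left[of f] ab by simp
  then have eq: "seg_y e z = seg_y f z" for z
    using seg_y_eq_at_two[of e "fst (fst e)" f x z] x by simp
  have V: "snd e \<in> V" "snd f \<in> V" and o: "fst (fst e) < fst (snd e)" "fst (fst f) < fst (snd f)"
    and inj: "inj_on fst V"
    using D e by (auto simp: drawing_def)
  have nv: "over e (fst v) \<Longrightarrow> v \<in> V \<Longrightarrow> seg_y e (fst v) \<noteq> snd v" 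
    "over f (fst v) \<Longrightarrow> v \<in> V \<Longrightarrow> seg_y f (fst v) \<noteq> snd v" for v
    using D e by (auto simp: drawing_def)
  have "snd e \<noteq> snd f" using ne ab by (simp add: prod_eq_iff)
  then have "fst (snd e) \<noteq> fst (snd f)" using inj V by (auto dest: inj_onD)
  then consider "fst (snd e) < fst (snd f)" | "fst (snd f) < fst (snd e)" by linarith
  then show False
  proof cases
    case 1
    then have "over f (fst (snd e))" using o ab by (auto simp: over_def)
    from nv(2)[OF this V(1)] show False using eq[of "fst (snd e)"] o by simp
  next
    case 2
    then have "over e (fst (snd f))" using o ab by (auto simp: over_def)
    from nv(1)[OF this V(2)] show False using eq[of "fst (snd f)"] o by simp
  qed
qed

lemma drawing_same_right:
  assumes D: "drawing V E" and e: "e \<in> E" "f \<in> E" and ab: "snd e = snd f"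
    and x: "x < fst (snd e)" "seg_y e x = seg_y f x"
  shows "e = f"
proof (rule ccontr)
  assume ne: "e \<noteq> f"
  have V: "fst e \<in> V" "fst f \<in> V" and o: "fst (fst e) < fst (snd e)" "fst (fst f) < fst (snd f)"
    and inj: "inj_on fst V"
    using D e by (auto simp: drawing_def)
  have eq: "seg_y e z = seg_y f z" for z
    by (rule seg_y_eq_at_two[of e "fst (snd e)" f x])
       (use x ab o seg_y_right[of e] seg_y_right[of f] in \<open>auto\<close>)
  have nv: "over e (fst v) \<Longrightarrow> v \<in> V \<Longrightarrow> seg_y e (fst v) \<noteq> snd v" 
    "over f (fst v) \<Longrightarrow> v \<in> V \<Longrightarrow> seg_y f (fst v) \<noteq> snd v" for v
    using D e by (auto simp: drawing_def)
  have "fst e \<noteq> fst f" using ne ab by (simp add: prod_eq_iff)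
  then have "fst (fst e) \<noteq> fst (fst f)" using inj V by (auto dest: inj_onD)
  then consider "fst (fst e) < fst (fst f)" | "fst (fst f) < fst (fst e)" by linarith
  then show False
  proof cases
    case 1
    then have "over e (fst (fst f))" using o ab by (auto simp: over_def)
    from nv(1)[OF this V(2)] show False using eq[of "fst (fst f)"] o by simp
  next
    case 2
    then have "over f (fst (fst e))" using o ab by (auto simp: over_def)
    from nv(2)[OF this V(1)] show False using eq[of "fst (fst e)"] o by simp
  qed
qed

text \<open>Crossing edges with a common left or right endpoint would coincide. The four distinct
  vertices are what gives a crossing the survival probability \<open>p ^ 4\<close> under random
  sampling.\<close>

lemma crosses_endpoints_distinct:
  assumes D: "drawing V E" and e: "e \<in> E" "f \<in> E" and c: "crosses e f"
  shows "card {fst e, snd e, fst f, snd f} = 4"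
proof -
  from c obtain x where x: "over e x" "over f x" "seg_y e x = seg_y f x" and ne: "e \<noteq> f"
    by (auto simp: crosses_def)
  have o: "fst (fst e) < fst (snd e)" "fst (fst f) < fst (snd f)" using D e by (auto simp: drawing_def)
  have "fst e \<noteq> fst f" using drawing_same_left[OF D e _ _ x(3)] x ne by (auto simp: over_def)
  moreover have "snd e \<noteq> snd f" using drawing_same_right[OF D e _ _ x(3)] x ne by (auto simp: over_def)
  moreover have "fst e \<noteq> snd e" "fst f \<noteq> snd f" "fst e \<noteq> snd f" "snd e \<noteq> fst f" 
    using o x by (auto simp: over_def)
  ultimately show ?thesis by simp
qed

text \<open>If \<open>e = ab\<close> is neither the topmost edge to the right of \<open>a\<close> nor the topmost edge to the left
  of \<open>b\<close>, then the wedge between \<open>e\<close> and the next edge above it at \<open>a\<close> contains a vertex over \<open>e\<close>.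
  The leftmost such vertex sees \<open>e\<close> vertically below it.\<close>

lemma plane_edge_trichotomy:
  assumes D: "drawing V E" and nc: "\<And>e f. e \<in> E \<Longrightarrow> f \<in> E \<Longrightarrow> \<not> crosses e f" and e: "e \<in> E"
    and L: "\<exists>f\<in>E. fst f = fst e \<and> (\<exists>x > fst (fst e). seg_y e x < seg_y f x)"
    and R: "\<exists>g\<in>E. snd g = snd e \<and> (\<exists>x < fst (snd e). seg_y e x < seg_y g x)"
  shows "\<exists>v\<in>V. over e (fst v) \<and> seg_y e (fst v) < snd v \<and>
    (\<forall>h\<in>E. over h (fst v) \<and> seg_y h (fst v) < snd v \<longrightarrow> seg_y h (fst v) \<le> seg_y e (fst v))"
proof -
  define a b where "a = fst e" and "b = snd e"
  have finV: "finite V" and inj: "inj_on fst V" and EV: "E \<subseteq> V \<times> V" using D by (auto simp: drawing_def)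
  have finE: "finite E" using EV finV finite_subset by blast
  have o: "fst (fst h) < fst (snd h)" if "h \<in> E" for h using D that by (auto simp: drawing_def)
  have nv: "seg_y h (fst v) \<noteq> snd v" if "h \<in> E" "v \<in> V" "over h (fst v)" for h v
    using D that by (auto simp: drawing_def)
  have ends: "fst h \<in> V" "snd h \<in> V" if "h \<in> E" for h using EV that by auto
  have injD: "v = w" if "v \<in> V" "w \<in> V" "fst v = fst w" for v w using inj that by (auto dest: inj_onD)
  have ab: "fst a < fst b" using o[OF e] by (simp add: a_def b_def)
  define F where "F = {f\<in>E. fst f = a \<and> (\<exists>x > fst a. seg_y e x < seg_y f x)}"
  from L obtain f0 where "f0 \<in> E" "fst f0 = a" "\<exists>x > fst a. seg_y e x < seg_y f0 x"
    unfolding a_def by blast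
  then have "f0 \<in> F" unfolding F_def by simp
  then have F: "F \<noteq> {}" by blast
  have finF: "finite F" using finE by (simp add: F_def)
  have above: "seg_y e x < seg_y f x" if "f \<in> F" "fst a < x" for f x
  proof -
    from that obtain x1 where "fst a < x1" "seg_y e x1 < seg_y f x1" by (auto simp: F_def)
    moreover have "seg_y e (fst a) = seg_y f (fst a)" using that(1) seg_y_left[of e] seg_y_left[of f]
      by (auto simp: F_def a_def)
    ultimately show ?thesis using seg_y_between that(2) by blast
  qed
  \<comment> \<open>\<open>f\<close> is the lowest edge at \<open>a\<close> above \<open>e\<close>.
    All these edges start at \<open>a\<close>, so their order at the single abscissa
    \<open>fst a + 1\<close> is their order everywhere to the right.\<close>
  obtain f where f: "f \<in> F" and fmin: "\<And>h. h \<in> F \<Longrightarrow> seg_y f (fst a + 1) \<le> seg_y h (fst a + 1)"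
    using arg_min_if_finite(1)[OF finF F, of "\<lambda>h. seg_y h (fst a + 1)"]
      arg_min_least[OF finF F, of _ "\<lambda>h. seg_y h (fst a + 1)"] by blast
  have fE: "f \<in> E" and fa: "fst f = a" using f by (auto simp: F_def)
  define c where "c = snd f"
  have ac: "fst a < fst c" using o[OF fE] fa by (simp add: c_def)
  have fy: "seg_y f (fst a) = snd a" "seg_y e (fst a) = snd a" "seg_y e (fst b) = snd b" "seg_y f (fst c) = snd c"
    using seg_y_left[of f] seg_y_left[of e] seg_y_right[OF o[OF e]] seg_y_right[OF o[OF fE]] fa 
    by (auto simp: a_def b_def c_def)
  have oe: "over e x \<longleftrightarrow> fst a < x \<and> x < fst b" and of: "over f x \<longleftrightarrow> fst a < x \<and> x < fst c" for x
    using fa by (auto simp: over_def a_def b_def c_def)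
  have nocross: "h = h'" if "h \<in> E" "h' \<in> E" "over h x" "over h' x" "seg_y h x = seg_y h' x" for h h' x
    using nc[OF that(1,2)] that by (auto simp: crosses_def)
  \<comment> \<open>The vertices in the wedge. Its upper side and the abscissa of \<open>c\<close>
    are included, so that \<open>c\<close> itself qualifies when it lies over
    \<open>e\<close>.\<close>
  define W where "W = {v\<in>V. over e (fst v) \<and> fst v \<le> fst c \<and> seg_y e (fst v) < snd v \<and> snd v \<le> seg_y f (fst v)}"
  have W: "W \<noteq> {}"
  proof (cases "fst c < fst b")
    case True
    then have "c \<in> W" using ends[OF fE] ac above[OF f ac] fy by (auto simp: W_def oe c_def)
    then show ?thesis by blast
  next
    case False
    have "c \<noteq> b" using above[OF f ab] fy by auto
    then have "fst c \<noteq> fst b" using injD[of c b] ends[OF fE] ends[OF e] unfolding b_def c_def by blast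
    then have bc: "fst b < fst c" using False by simp
    \<comment> \<open>Here \<open>f\<close> passes above \<open>b\<close>, while \<open>g\<close>
      ends at \<open>b\<close> and runs above \<open>e\<close>. As \<open>g\<close> cannot cross
      \<open>f\<close>, its left endpoint \<open>d\<close> is forced into the wedge.\<close>
    obtain g x1 where g: "g \<in> E" "snd g = b" "x1 < fst b" "seg_y e x1 < seg_y g x1"
      using R by (auto simp: b_def)
    define d where "d = fst g"
    have db: "fst d < fst b" using o[OF g(1)] g(2) by (simp add: d_def)
    have gy: "seg_y g (fst d) = snd d" "seg_y g (fst b) = snd b"
      using seg_y_left[of g] seg_y_right[OF o[OF g(1)]] g(2) by (auto simp: d_def)
    have og: "over g x \<longleftrightarrow> fst d < x \<and> x < fst b" for x using g(2) by (auto simp: over_def d_def)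
    have ge: "seg_y e x < seg_y g x" if "x < fst b" for x
      using seg_y_between[of e "fst b" g x1 x] g that fy gy by simp
    have dV: "d \<in> V" using ends g by (auto simp: d_def)
    have da: "fst a < fst d"
    proof (rule ccontr)
      assume "\<not> fst a < fst d"
      then have "fst d \<le> fst a" by simp
      have 1: "seg_y f (fst a) < seg_y g (fst a)" using ge[OF ab] fy by simp
      have 2: "seg_y g (fst b) < seg_y f (fst b)" using above[OF f ab] fy gy by simp
      obtain x where x: "fst a < x" "x < fst b" "seg_y f x = seg_y g x"
        using seg_y_sign_change[OF 1 2] ab by auto
      have "f = g" using nocross[OF fE g(1), of x] x bc \<open>fst d \<le> fst a\<close> by (auto simp: of og)
      then show False using 1 by simp
    qed
    have "seg_y e (fst d) < snd d" using ge[OF db] gy by simp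
    moreover have "snd d \<le> seg_y f (fst d)"
    proof (rule ccontr)
      assume "\<not> snd d \<le> seg_y f (fst d)"
      then have 1: "seg_y f (fst d) < seg_y g (fst d)" using gy by simp
      have 2: "seg_y g (fst b) < seg_y f (fst b)" using above[OF f ab] fy gy by simp
      obtain x where x: "fst d < x" "x < fst b" "seg_y f x = seg_y g x"
        using seg_y_sign_change[OF 1 2] db by auto
      have "f = g" using nocross[OF fE g(1), of x] x bc da by (auto simp: of og)
      then show False using 1 by simp
    qed
    ultimately have "d \<in> W" using dV da db bc by (auto simp: W_def oe)
    then show ?thesis by blast
  qed
  have finW: "finite W" using finV by (simp add: W_def)
  obtain v where v: "v \<in> W" and vmin: "\<And>w. w \<in> W \<Longrightarrow> fst v \<le> fst w"
    using arg_min_if_finite(1)[OF finW W, of fst] arg_min_least[OF finW W, of _ fst] by blast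
  have vV: "v \<in> V" and ev: "over e (fst v)" and vc: "fst v \<le> fst c" 
    and ve: "seg_y e (fst v) < snd v" and vf: "snd v \<le> seg_y f (fst v)"
    using v by (auto simp: W_def)
  have av: "fst a < fst v" "fst v < fst b" using ev by (auto simp: oe)
  have "seg_y h (fst v) \<le> seg_y e (fst v)" if h: "h \<in> E" "over h (fst v)" "seg_y h (fst v) < snd v" for h
  proof (rule ccontr)
    assume "\<not> ?thesis"
    then have he: "seg_y e (fst v) < seg_y h (fst v)" by simp
    have hf: "seg_y h (fst v) < seg_y f (fst v)" using h vf by simp
    \<comment> \<open>Follow the offending edge \<open>h\<close> back to its left endpoint. To the
      right of \<open>a\<close> it would lie in the wedge, further left than \<open>v\<close>; at
      \<open>a\<close> it contradicts the choice of \<open>f\<close>; left of \<open>a\<close>,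
      \<open>h\<close> must cross \<open>e\<close> or \<open>f\<close> on its way, since it misses
      the vertex \<open>a\<close>.\<close>
    define p where "p = fst h"
    have pV: "p \<in> V" using ends h by (auto simp: p_def)
    have py: "seg_y h (fst p) = snd p" by (simp add: p_def)
    have pv: "fst p < fst v" and vr: "fst v < fst (snd h)" using h by (auto simp: over_def p_def)
    have oh: "over h x" if "fst p < x" "x \<le> fst v" for x using that vr by (auto simp: over_def p_def)
    have noe: False if "x < fst v" "fst p < x" "fst a < x" "seg_y e x = seg_y h x" for x
      using nocross[OF e h(1), of x] that oh av he by (auto simp: oe)
    have nof: False if "x < fst v" "fst p < x" "fst a < x" "seg_y f x = seg_y h x" for x
      using nocross[OF fE h(1), of x] that oh av hf vc by (auto simp: of)
    consider "fst a < fst p" | "fst a = fst p" | "fst p < fst a" by linarith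
    then show False
    proof cases
      case 1
      have oep: "over e (fst p)" using 1 pv av by (auto simp: oe)
      have "seg_y e (fst p) < snd p"
      proof (rule ccontr)
        assume "\<not> ?thesis"
        then have "seg_y h (fst p) < seg_y e (fst p)" using nv[OF e pV oep] py by simp
        from seg_y_sign_change[OF this he] obtain x where 
          "fst p < x" "x < fst v" "seg_y h x = seg_y e x" using pv by auto
        then show False using noe[of x] 1 by simp
      qed
      moreover have "snd p \<le> seg_y f (fst p)"
      proof (rule ccontr)
        assume "\<not> ?thesis"
        then have "seg_y f (fst p) < seg_y h (fst p)" using py by simp
        from seg_y_sign_change[OF this hf] obtain x where 
          "fst p < x" "x < fst v" "seg_y f x = seg_y h x" using pv by auto
        then show False using nof[of x] 1 by simp
      qed
      ultimately have "p \<in> W" using pV oep pv vc by (auto simp: W_def)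
      from vmin[OF this] pv show False by simp
    next
      case 2
      then have pa: "fst h = a" using injD[OF _ pV, of a] ends[OF e] by (auto simp: a_def p_def)
      then have hF: "h \<in> F" using h he av by (auto simp: F_def)
      have "seg_y h (fst a) = seg_y f (fst a)" using pa py fy by (simp add: p_def)
      from seg_y_between[OF this hf, of "fst a + 1"] av have "seg_y h (fst a + 1) < seg_y f (fst a + 1)" by simp
      with fmin[OF hF] show False by simp
    next
      case 3
      have aV: "a \<in> V" using ends[OF e] by (simp add: a_def)
      have "seg_y h (fst a) \<noteq> snd a" using nv[OF h(1) aV] oh[OF 3] av by simp
      then consider "seg_y f (fst a) < seg_y h (fst a)" | "seg_y h (fst a) < seg_y e (fst a)" 
        using fy by linarith
      then show False
      proof cases
        case 1
        from seg_y_sign_change[OF this hf] obtain x where 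
          "fst a < x" "x < fst v" "seg_y f x = seg_y h x" using av by auto
        then show False using nof[of x] 3 by simp
      next
        case 2
        from seg_y_sign_change[OF this he] obtain x where 
          "fst a < x" "x < fst v" "seg_y h x = seg_y e x" using av by auto
        then show False using noe[of x] 3 by simp
      qed
    qed
  qed
  then show ?thesis using vV ev ve by blast
qed

text \<open>Every edge is topmost at its left end, topmost at its right end, or the first edge below
  some vertex, and each class injects into \<open>V\<close>. For the third class, two distinct edges
  directly below one vertex would cross there.\<close>

lemma plane_drawing_card_edges:
  assumes D: "drawing V E" and nc: "\<And>e f. e \<in> E \<Longrightarrow> f \<in> E \<Longrightarrow> \<not> crosses e f"
  shows "card E \<le> 3 * card V"
proof -
  have finV: "finite V" and EV: "E \<subseteq> V \<times> V" using D by (auto simp: drawing_def)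
  have finE: "finite E" using EV finV finite_subset by blast
  define A where "A = {e\<in>E. \<not> (\<exists>f\<in>E. fst f = fst e \<and> (\<exists>x > fst (fst e). seg_y e x < seg_y f x))}"
  define B where "B = {e\<in>E. \<not> (\<exists>g\<in>E. snd g = snd e \<and> (\<exists>x < fst (snd e). seg_y e x < seg_y g x))}"
  define P where "P e v \<longleftrightarrow> v \<in> V \<and> over e (fst v) \<and> seg_y e (fst v) < snd v \<and>
    (\<forall>h\<in>E. over h (fst v) \<and> seg_y h (fst v) < snd v \<longrightarrow> seg_y h (fst v) \<le> seg_y e (fst v))" for e v
  define C where "C = {e\<in>E. \<exists>v. P e v}"
  have "e \<in> A \<union> B \<union> C" if e: "e \<in> E" for e
  proof (rule ccontr)
    assume n: "e \<notin> A \<union> B \<union> C"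
    have "\<exists>v. P e v"
    proof -
      have "\<exists>f\<in>E. fst f = fst e \<and> (\<exists>x > fst (fst e). seg_y e x < seg_y f x)"
        using n e unfolding A_def by blast
      moreover have "\<exists>g\<in>E. snd g = snd e \<and> (\<exists>x < fst (snd e). seg_y e x < seg_y g x)"
        using n e unfolding B_def by blast
      ultimately obtain v where "v \<in> V" "over e (fst v)" "seg_y e (fst v) < snd v"
        "\<forall>h\<in>E. over h (fst v) \<and> seg_y h (fst v) < snd v \<longrightarrow> seg_y h (fst v) \<le> seg_y e (fst v)"
        using plane_edge_trichotomy[OF D nc e] by blast
      then have "P e v" unfolding P_def by simp
      then show ?thesis ..
    qed
    then show False using n e by (simp add: C_def)
  qed
  then have "E \<subseteq> A \<union> B \<union> C" by (rule subsetI)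
  then have "card E \<le> card (A \<union> B \<union> C)"
    by (intro card_mono) (auto simp: A_def B_def C_def finE)
  also have "\<dots> \<le> card A + card B + card C"
    using card_Un_le[of "A \<union> B" C] card_Un_le[of A B] by linarith
  also have "card A \<le> card V"
  proof (rule card_inj_on_le[where f = fst])
    show "inj_on fst A"
    proof (rule inj_onI)
      fix e f assume ef: "e \<in> A" "f \<in> A" "fst e = fst f"
      then have E: "e \<in> E" "f \<in> E" by (auto simp: A_def)
      define x where "x = fst (fst e) + 1"
      have x: "fst (fst e) < x" "fst (fst f) < x" using ef by (auto simp: x_def)
      have "\<not> seg_y e x < seg_y f x" "\<not> seg_y f x < seg_y e x" using ef x unfolding A_def by auto
      then show "e = f" using drawing_same_left[OF D E ef(3) x(1)] by force
    qed
  qed (use EV finV in \<open>auto simp: A_def\<close>)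
  also have "card B \<le> card V"
  proof (rule card_inj_on_le[where f = snd])
    show "inj_on snd B"
    proof (rule inj_onI)
      fix e f assume ef: "e \<in> B" "f \<in> B" "snd e = snd f"
      then have E: "e \<in> E" "f \<in> E" by (auto simp: B_def)
      define x where "x = fst (snd e) - 1"
      have x: "x < fst (snd e)" "x < fst (snd f)" using ef by (auto simp: x_def)
      have "\<not> seg_y e x < seg_y f x" "\<not> seg_y f x < seg_y e x" using ef x by (auto simp: B_def)
      then show "e = f" using drawing_same_right[OF D E ef(3) x(1)] by force
    qed
  qed (use EV finV in \<open>auto simp: B_def\<close>)
  also have "card C \<le> card V"
  proof (rule card_inj_on_le[where f = "\<lambda>e. SOME v. P e v"])
    have S: "P e (SOME v. P e v)" if "e \<in> C" for e
      using that by (auto simp: C_def intro: someI)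
    then show "(\<lambda>e. SOME v. P e v) ` C \<subseteq> V" by (auto simp: P_def)
    show "inj_on (\<lambda>e. SOME v. P e v) C"
    proof (rule inj_onI)
      fix e f assume ef: "e \<in> C" "f \<in> C" "(SOME v. P e v) = (SOME v. P f v)"
      define v where "v = (SOME v. P e v)"
      have "P e v" using S[OF ef(1)] by (simp add: v_def)
      moreover have "P f v" using S[OF ef(2)] ef(3) by (simp add: v_def)
      moreover have "seg_y e (fst v) = seg_y f (fst v)"
      proof (rule antisym)
        show "seg_y e (fst v) \<le> seg_y f (fst v)" using \<open>P e v\<close> \<open>P f v\<close> ef unfolding P_def C_def by blast
        show "seg_y f (fst v) \<le> seg_y e (fst v)" using \<open>P e v\<close> \<open>P f v\<close> ef unfolding P_def C_def by blast
      qed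
      ultimately show "e = f" using nc[of e f] ef unfolding P_def C_def crosses_def by blast
    qed
  qed (use finV in auto)
  finally show ?thesis by simp
qed

section \<open>The crossing lemma\<close>

text \<open>Discarding every edge that takes part in a crossing leaves a plane drawing, and no more
  edges are discarded than there are ordered crossing pairs.\<close>

lemma drawing_card_edges_le_crossings:
  assumes D: "drawing V E"
  shows "card E \<le> 3 * card V + card {(e, f) \<in> E \<times> E. crosses e f}"
proof -
  let ?X = "{(e, f) \<in> E \<times> E. crosses e f}"
  have finE: "finite E" using D finite_subset[of E "V \<times> V"] by (auto simp: drawing_def)
  have finX: "finite ?X" by (rule finite_subset[of _ "E \<times> E"]) (use finE in auto)
  define E' where "E' = E - fst ` ?X"
  have "drawing V E'" using D by (auto simp: drawing_def E'_def)
  moreover have "\<not> crosses e f" if "e \<in> E'" "f \<in> E'" for e f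
    using that unfolding E'_def by force
  ultimately have "card E' \<le> 3 * card V" using plane_drawing_card_edges by blast
  moreover have "card E \<le> card E' + card (fst ` ?X)"
    unfolding E'_def using diff_card_le_card_Diff[of "fst ` ?X" E] finX by (simp add: le_diff_conv)
  moreover have "card (fst ` ?X) \<le> card ?X" using finX by (rule card_image_le)
  ultimately show ?thesis by linarith
qed

text \<open>The weight \<open>p ^ card A * (1 - p) ^ card (V - A)\<close> is the probability of \<open>A\<close> when every point of
  \<open>V\<close> is kept independently with probability \<open>p\<close>.\<close>

lemma sum_random_subset:
  fixes p :: real
  assumes "finite V" "Q \<subseteq> V"
  shows "(\<Sum>A\<in>{A\<in>Pow V. Q \<subseteq> A}. p ^ card A * (1 - p) ^ card (V - A)) = p ^ card Q"
proof -
  \<comment> \<open>The zeros on \<open>Q\<close> annihilate every term whose \<open>A\<close>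
    misses a point of \<open>Q\<close>. Expanding the product of the \<open>p + ?g x\<close>
    therefore leaves the supersets of \<open>Q\<close>, while the product itself has a factor
    \<open>p\<close> on \<open>Q\<close> and 1 elsewhere.\<close>
  let ?g = "\<lambda>x. if x \<in> Q then 0 else 1 - p"
  have g: "(\<Prod>x\<in>V - A. ?g x) = (if Q \<subseteq> A then (1 - p) ^ card (V - A) else 0)" if "A \<in> Pow V" for A
  proof (cases "Q \<subseteq> A")
    case True
    then have "(\<Prod>x\<in>V - A. ?g x) = (\<Prod>x\<in>V - A. 1 - p)" by (intro prod.cong) auto
    then show ?thesis using True by simp
  next
    case False
    then have "\<exists>x\<in>V - A. ?g x = 0" using assms by auto
    then have "(\<Prod>x\<in>V - A. ?g x) = 0" using assms(1) by (intro prod_zero) auto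
    then show ?thesis using False by simp
  qed
  have "(\<Prod>x\<in>V. p + ?g x) = (\<Sum>A\<in>Pow V. (\<Prod>x\<in>A. p) * (\<Prod>x\<in>V - A. ?g x))"
    by (rule prod_add[OF assms(1)])
  also have "\<dots> = (\<Sum>A\<in>Pow V. if Q \<subseteq> A then p ^ card A * (1 - p) ^ card (V - A) else 0)"
    by (intro sum.cong refl) (simp add: g)
  also have "\<dots> = (\<Sum>A\<in>{A\<in>Pow V. Q \<subseteq> A}. p ^ card A * (1 - p) ^ card (V - A))"
    by (rule sum.inter_filter[symmetric]) (use assms(1) in simp)
  finally have "(\<Sum>A\<in>{A\<in>Pow V. Q \<subseteq> A}. p ^ card A * (1 - p) ^ card (V - A)) = (\<Prod>x\<in>V. p + ?g x)" ..
  also have "\<dots> = (\<Prod>x\<in>V. if x \<in> Q then p else 1)" by (intro prod.cong) auto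
  also have "\<dots> = (\<Prod>x\<in>Q. p)" using assms
    by (simp add: prod.If_cases Int_absorb1)
  finally show ?thesis by simp
qed

text \<open>Linearity of expectation: each \<open>z\<close> survives exactly when all
  \<open>k\<close> points of \<open>supp z\<close> are kept.\<close>

lemma sum_random_card:
  fixes p :: real
  assumes "finite V" "finite Z" "\<And>z. z \<in> Z \<Longrightarrow> supp z \<subseteq> V \<and> card (supp z) = k"
  shows "(\<Sum>A\<in>Pow V. p ^ card A * (1 - p) ^ card (V - A) * real (card {z\<in>Z. supp z \<subseteq> A})) = p ^ k * real (card Z)"
proof -
  let ?w = "\<lambda>A. p ^ card A * (1 - p) ^ card (V - A)"
  have "(\<Sum>A\<in>Pow V. ?w A * real (card {z\<in>Z. supp z \<subseteq> A})) = (\<Sum>A\<in>Pow V. \<Sum>z\<in>Z. if supp z \<subseteq> A then ?w A else 0)"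
  proof (intro sum.cong refl)
    fix A
    have "(\<Sum>z\<in>Z. if supp z \<subseteq> A then ?w A else 0) = (\<Sum>z\<in>{z\<in>Z. supp z \<subseteq> A}. ?w A)"
      using assms(2) by (simp only: sum.inter_filter)
    then show "?w A * real (card {z\<in>Z. supp z \<subseteq> A}) = (\<Sum>z\<in>Z. if supp z \<subseteq> A then ?w A else 0)"
      by simp
  qed
  also have "\<dots> = (\<Sum>z\<in>Z. \<Sum>A\<in>Pow V. if supp z \<subseteq> A then ?w A else 0)" by (rule sum.swap)
  also have "\<dots> = (\<Sum>z\<in>Z. p ^ k)"
  proof (intro sum.cong refl)
    fix z assume z: "z \<in> Z"
    have "(\<Sum>A\<in>Pow V. if supp z \<subseteq> A then ?w A else 0) = (\<Sum>A\<in>{A\<in>Pow V. supp z \<subseteq> A}. ?w A)"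
      using assms(1) by (simp only: sum.inter_filter finite_Pow_iff)
    then show "(\<Sum>A\<in>Pow V. if supp z \<subseteq> A then ?w A else 0) = p ^ k"
      using sum_random_subset[of V "supp z" p] assms z by simp
  qed
  finally show ?thesis by simp
qed

text \<open>The expectation of the preceding inequality for the subdrawing induced by a random
  vertex set: vertices, edges and crossings survive with probability \<open>p\<close>,
  \<open>p ^ 2\<close> and \<open>p ^ 4\<close>.\<close>

lemma drawing_crossings_random:
  fixes p :: real
  assumes D: "drawing V E" and p: "0 \<le> p" "p \<le> 1"
  shows "p ^ 2 * real (card E) \<le> 3 * p * real (card V) + p ^ 4 * real (card {(e, f) \<in> E \<times> E. crosses e f})"
proof -
  let ?X = "{(e, f) \<in> E \<times> E. crosses e f}"
  let ?w = "\<lambda>A. p ^ card A * (1 - p) ^ card (V - A)"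
  let ?se = "\<lambda>e. {fst e, snd e}"
  let ?sx = "\<lambda>z. {fst (fst z), snd (fst z), fst (snd z), snd (snd z)}"
  have finV: "finite V" and EV: "E \<subseteq> V \<times> V" using D by (auto simp: drawing_def)
  have finE: "finite E" using EV finV finite_subset by blast
  have finX: "finite ?X" by (rule finite_subset[of _ "E \<times> E"]) (use finE in auto)
  have le: "?w A * real (card {e\<in>E. ?se e \<subseteq> A}) \<le>
      3 * (?w A * real (card {v\<in>V. {v} \<subseteq> A})) + ?w A * real (card {z\<in>?X. ?sx z \<subseteq> A})" if A: "A \<in> Pow V" for A
  proof -
    have d: "drawing A {e\<in>E. ?se e \<subseteq> A}"
      unfolding drawing_def
    proof (intro conjI ballI impI)
      show "finite A" using A finV finite_subset by auto
      show "inj_on fst A" using D A inj_on_subset by (auto simp: drawing_def)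
      show "{e \<in> E. ?se e \<subseteq> A} \<subseteq> A \<times> A" by (auto simp: mem_Times_iff)
      show "fst (fst e) < fst (snd e)" if "e \<in> {e \<in> E. ?se e \<subseteq> A}" for e
        using D that by (auto simp: drawing_def)
      show "seg_y e (fst v) \<noteq> snd v" if "e \<in> {e \<in> E. ?se e \<subseteq> A}" "v \<in> A" "over e (fst v)" for e v
        using D A that unfolding drawing_def by blast
    qed
    have eq: "{(e, f) \<in> {e\<in>E. ?se e \<subseteq> A} \<times> {e\<in>E. ?se e \<subseteq> A}. crosses e f} = {z\<in>?X. ?sx z \<subseteq> A}"
      by auto
    have "A = {v\<in>V. {v} \<subseteq> A}" using A by auto
    then have "real (card {e\<in>E. ?se e \<subseteq> A}) \<le> 3 * real (card {v\<in>V. {v} \<subseteq> A}) + real (card {z\<in>?X. ?sx z \<subseteq> A})"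
      using drawing_card_edges_le_crossings[OF d] unfolding eq by simp
    then have "?w A * real (card {e\<in>E. ?se e \<subseteq> A}) \<le> 
      ?w A * (3 * real (card {v\<in>V. {v} \<subseteq> A}) + real (card {z\<in>?X. ?sx z \<subseteq> A}))"
      using p by (intro mult_left_mono) auto
    then show ?thesis by (simp add: algebra_simps)
  qed
  have "p ^ 2 * real (card E) = (\<Sum>A\<in>Pow V. ?w A * real (card {e\<in>E. ?se e \<subseteq> A}))"
  proof (rule sum_random_card[OF finV finE, symmetric])
    fix e assume e: "e \<in> E"
    then have "fst e \<noteq> snd e" using D by (auto simp: drawing_def)
    then show "{fst e, snd e} \<subseteq> V \<and> card {fst e, snd e} = 2" using EV e by (auto simp: mem_Times_iff)
  qed
  also have "\<dots> \<le> (\<Sum>A\<in>Pow V. 3 * (?w A * real (card {v\<in>V. {v} \<subseteq> A})) + ?w A * real (card {z\<in>?X. ?sx z \<subseteq> A}))"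
    by (rule sum_mono) (rule le)
  also have "\<dots> = 3 * (\<Sum>A\<in>Pow V. ?w A * real (card {v\<in>V. {v} \<subseteq> A})) +
      (\<Sum>A\<in>Pow V. ?w A * real (card {z\<in>?X. ?sx z \<subseteq> A}))"
    by (simp add: sum.distrib sum_distrib_left)
  also have "(\<Sum>A\<in>Pow V. ?w A * real (card {v\<in>V. {v} \<subseteq> A})) = p ^ 1 * real (card V)"
    by (rule sum_random_card) (use finV in auto)
  also have "(\<Sum>A\<in>Pow V. ?w A * real (card {z\<in>?X. ?sx z \<subseteq> A})) = p ^ 4 * real (card ?X)"
  proof (rule sum_random_card[OF finV finX])
    fix z assume "z \<in> ?X"
    then obtain e f where z: "z = (e, f)" "e \<in> E" "f \<in> E" "crosses e f" by blast
    then show "?sx z \<subseteq> V \<and> card (?sx z) = 4"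
      using crosses_endpoints_distinct[OF D z(2-4)] EV by auto
  qed
  finally show ?thesis by simp
qed

text \<open>The density hypothesis makes \<open>6 * n / e\<close> a probability. With this choice
  the vertex term is half of the edge term, so the crossing term has to supply the other
  half.\<close>

lemma crossing_lemma:
  assumes D: "drawing V E" and big: "6 * card V \<le> card E"
  shows "real (card E) ^ 3 \<le> 72 * real (card V) ^ 2 * real (card {(e, f) \<in> E \<times> E. crosses e f})"
proof (cases "card V = 0")
  case True
  then have "V = {}" using D by (simp add: drawing_def)
  then have "E = {}" using D by (auto simp: drawing_def)
  then show ?thesis by simp
next
  case False
  define n e X where "n = real (card V)" and "e = real (card E)" and "X = real (card {(e, f) \<in> E \<times> E. crosses e f})"
  have n: "n > 0" "6 * n \<le> e" using False big by (auto simp: n_def e_def)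
  then have e: "e > 0" by linarith
  \<comment> \<open>sampling with \<open>p = 6 n / e\<close>\<close>
  have "(6 * n / e) ^ 2 * e \<le> 3 * (6 * n / e) * n + (6 * n / e) ^ 4 * X"
    unfolding n_def e_def X_def
    by (rule drawing_crossings_random[OF D]) (use n e in \<open>auto simp: n_def e_def\<close>)
  moreover have "(6 * n / e) ^ 2 * e = 36 * n ^ 2 / e" using e by (simp add: power2_eq_square field_simps)
  moreover have "3 * (6 * n / e) * n = 18 * n ^ 2 / e" by (simp add: power2_eq_square)
  moreover have "36 * n ^ 2 / e = 2 * (18 * n ^ 2 / e)" by simp
  moreover have "(6 * n / e) ^ 4 * X = (18 * n ^ 2 / e) * (72 * n ^ 2 * X / e ^ 3)"
    by (simp add: field_simps power_mult_distrib eval_nat_numeral)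
  ultimately have "(18 * n ^ 2 / e) * 1 \<le> (18 * n ^ 2 / e) * (72 * n ^ 2 * X / e ^ 3)" by linarith
  then have "1 \<le> 72 * n ^ 2 * X / e ^ 3" using n e by (subst (asm) mult_le_cancel_left_pos) auto
  then show ?thesis using e by (simp add: n_def e_def X_def field_simps)
qed

section \<open>Rich lines\<close>

text \<open>The line \<open>y = a x + b\<close> is represented by the pair \<open>(a, b)\<close>; vertical lines are not needed
  because point sets will have distinct first coordinates.\<close>

definition on_line :: "(real \<times> real) set \<Rightarrow> real \<times> real \<Rightarrow> (real \<times> real) set" where
  "on_line P l = {p\<in>P. snd p = fst l * fst p + snd l}"

text \<open>The segments between consecutive points of \<open>P\<close> on the line. Taken over all
  lines they form the drawing of Szekely's proof of the Szemeredi-Trotter theorem.\<close>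

definition line_edges :: "(real \<times> real) set \<Rightarrow> real \<times> real \<Rightarrow> ((real \<times> real) \<times> (real \<times> real)) set" where
  "line_edges P l = {e \<in> on_line P l \<times> on_line P l. fst (fst e) < fst (snd e) \<and>
     (\<forall>c\<in>on_line P l. \<not> over e (fst c))}"

lemma line_through_two_unique:
  fixes l l' :: "real \<times> real"
  assumes "fst l * x + snd l = fst l' * x + snd l'" "fst l * y + snd l = fst l' * y + snd l'" "x \<noteq> y"
  shows "l = l'"
proof -
  have "(fst l - fst l') * (x - y) = 0" using assms(1,2) by (simp add: algebra_simps)
  with assms(3) have "fst l = fst l'" by simp
  with assms(1) show ?thesis by (simp add: prod_eq_iff)
qed

lemma seg_y_line_edges:
  assumes "e \<in> line_edges P l"
  shows "seg_y e x = fst l * x + snd l"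
proof -
  define a b where "a = fst (fst e)" and "b = fst (snd e)"
  have ab: "a < b" "snd (fst e) = fst l * a + snd l" "snd (snd e) = fst l * b + snd l"
    using assms by (auto simp: line_edges_def on_line_def a_def b_def)
  have "snd (snd e) - snd (fst e) = fst l * (b - a)" using ab by (simp add: algebra_simps)
  then have "seg_y e x = fst l * a + snd l + fst l * (x - a)"
    unfolding seg_y_def using ab by (simp add: a_def[symmetric] b_def[symmetric])
  then show ?thesis by (simp add: algebra_simps)
qed

lemma line_edges_disjoint:
  assumes "e \<in> line_edges P l" "e \<in> line_edges P l'"
  shows "l = l'"
proof (rule line_through_two_unique)
  show "fst l * 0 + snd l = fst l' * 0 + snd l'" "fst l * 1 + snd l = fst l' * 1 + snd l'"
    using seg_y_line_edges[OF assms(1)] seg_y_line_edges[OF assms(2)] by metis+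
qed simp

lemma line_edges_over_unique:
  assumes P: "inj_on fst P" and e: "e \<in> line_edges P l" "f \<in> line_edges P l" and x: "over e x" "over f x"
  shows "e = f"
proof -
  have m: "fst e \<in> on_line P l" "snd e \<in> on_line P l" "fst f \<in> on_line P l" "snd f \<in> on_line P l"
    and n: "\<And>c. c \<in> on_line P l \<Longrightarrow> \<not> over e (fst c)" "\<And>c. c \<in> on_line P l \<Longrightarrow> \<not> over f (fst c)"
    using e by (auto simp: line_edges_def)
  have "fst (fst e) = fst (fst f)" "fst (snd e) = fst (snd f)"
    using x n(1)[OF m(3)] n(1)[OF m(4)] n(2)[OF m(1)] n(2)[OF m(2)] by (auto simp: over_def)
  then show ?thesis using P m by (auto simp: on_line_def prod_eq_iff dest!: inj_onD)
qed

text \<open>Every point of the line except the leftmost is the right end of the edge coming from its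
  nearest predecessor.\<close>

lemma card_line_edges:
  assumes P: "finite P" "inj_on fst P"
  shows "card (on_line P l) \<le> card (line_edges P l) + 1"
proof (cases "on_line P l = {}")
  case False
  let ?M = "on_line P l"
  have fM: "finite ?M" using P by (simp add: on_line_def)
  have fE: "finite (line_edges P l)"
    by (rule finite_subset[of _ "?M \<times> ?M"]) (use fM in \<open>auto simp: line_edges_def\<close>)
  have inj: "inj_on fst ?M" using P(2) by (rule inj_on_subset) (auto simp: on_line_def)
  define a0 where "a0 = arg_min_on fst ?M"
  have a0: "a0 \<in> ?M" "\<And>y. y \<in> ?M \<Longrightarrow> fst a0 \<le> fst y"
    using arg_min_if_finite(1)[OF fM False, of fst] arg_min_least[OF fM False, of _ fst] by (auto simp: a0_def)
  have "?M - {a0} \<subseteq> snd ` line_edges P l"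
  proof
    fix b assume b: "b \<in> ?M - {a0}"
    have "fst a0 \<noteq> fst b" using b a0(1) inj by (auto dest: inj_onD)
    then have "fst a0 < fst b" using a0(2)[of b] b by simp
    define L where "L = {a\<in>?M. fst a < fst b}"
    have "a0 \<in> L" using a0(1) \<open>fst a0 < fst b\<close> by (simp add: L_def)
    then have "L \<noteq> {}" by blast
    with fM have L: "finite L" "L \<noteq> {}" by (simp_all add: L_def)
    define a where "a = arg_min_on (\<lambda>c. - fst c) L"
    have a: "a \<in> L" "\<And>y. y \<in> L \<Longrightarrow> fst y \<le> fst a"
      using arg_min_if_finite(1)[OF L, of "\<lambda>c. - fst c"] arg_min_least[OF L, of _ "\<lambda>c. - fst c"] 
      by (auto simp: a_def)
    have "\<not> over (a, b) (fst c)" if "c \<in> ?M" for c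
      using a(2)[of c] that by (auto simp: over_def L_def)
    then have "(a, b) \<in> line_edges P l" using a(1) b by (auto simp: line_edges_def L_def)
    then show "b \<in> snd ` line_edges P l" by force
  qed
  then have "card (?M - {a0}) \<le> card (line_edges P l)"
    using fE by (meson card_image_le card_mono finite_imageI le_trans)
  then show ?thesis using a0(1) fM by simp
qed simp

text \<open>Let \<open>I\<close> be the number of incidences and \<open>E\<close> the set of all
  line edges. As \<open>k\<close> is at least 2, \<open>I\<close> is at most twice
  \<open>card E\<close>, and there are at most \<open>I / k\<close> lines. Two lines meet at most
  once, so the crossing lemma applies with at most \<open>(card L)\<^sup>2\<close> crossings. The
  first term of the maximum covers drawings with fewer than \<open>6 * card P\<close> edges.\<close>

lemma szemeredi_trotter:
  assumes P: "finite P" "inj_on fst P" and L: "finite L" and k: "2 \<le> k"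
    and rich: "\<And>l. l \<in> L \<Longrightarrow> k \<le> card (on_line P l)"
  shows "real (\<Sum>l\<in>L. card (on_line P l)) \<le> max (12 * real (card P)) (576 * real (card P) ^ 2 / real k ^ 2)"
proof -
  define E where "E = (\<Union>l\<in>L. line_edges P l)"
  have fE: "finite (line_edges P l)" for l
    by (rule finite_subset[of _ "P \<times> P"]) (use P in \<open>auto simp: line_edges_def on_line_def\<close>)
  have D: "drawing P E"
    unfolding drawing_def
  proof (intro conjI ballI impI)
    show "E \<subseteq> P \<times> P" by (auto simp: E_def line_edges_def on_line_def)
    fix e assume "e \<in> E"
    then obtain l where l: "l \<in> L" "e \<in> line_edges P l" by (auto simp: E_def)
    then show "fst (fst e) < fst (snd e)" by (simp add: line_edges_def)
    fix v assume v: "v \<in> P" "over e (fst v)"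
    show "seg_y e (fst v) \<noteq> snd v"
    proof
      assume "seg_y e (fst v) = snd v"
      then have "v \<in> on_line P l" using v seg_y_line_edges[OF l(2)] by (simp add: on_line_def)
      then show False using l v by (auto simp: line_edges_def)
    qed
  qed (use P in auto)
  have finE: "finite E" using fE L by (simp add: E_def)
  let ?X = "{(e, f) \<in> E \<times> E. crosses e f}"
  define I where "I = real (\<Sum>l\<in>L. card (on_line P l))"
  have "card E = (\<Sum>l\<in>L. card (line_edges P l))"
    unfolding E_def by (rule card_UN_disjoint) (use L fE line_edges_disjoint in blast)+
  moreover have "card (on_line P l) \<le> 2 * card (line_edges P l)" if "l \<in> L" for l
    using rich[OF that] k card_line_edges[OF P, of l] by linarith
  then have "(\<Sum>l\<in>L. card (on_line P l)) \<le> (\<Sum>l\<in>L. 2 * card (line_edges P l))" by (rule sum_mono)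
  ultimately have "(\<Sum>l\<in>L. card (on_line P l)) \<le> 2 * card E" by (simp add: sum_distrib_left)
  then have IE: "I \<le> 2 * real (card E)" unfolding I_def by linarith
  have "(\<Sum>l\<in>L. k) \<le> (\<Sum>l\<in>L. card (on_line P l))" using rich by (rule sum_mono)
  then have "real (card L * k) \<le> I" unfolding I_def by (subst of_nat_le_iff) simp
  then have LI: "real (card L) * real k \<le> I" by simp
  define g where "g e = (SOME l. l \<in> L \<and> e \<in> line_edges P l)" for e
  have g: "g e \<in> L" "e \<in> line_edges P (g e)" if "e \<in> E" for e
    using that someI_ex[of "\<lambda>l. l \<in> L \<and> e \<in> line_edges P l"] by (auto simp: E_def g_def)
  \<comment> \<open>The two lines determine the crossing pair: distinct lines agree at one abscissa
    only, and each has at most one edge over it.\<close>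
  have "card ?X \<le> card (L \<times> L)"
  proof (rule card_inj_on_le[where f = "\<lambda>(e, f). (g e, g f)"])
    show "inj_on (\<lambda>(e, f). (g e, g f)) ?X"
    proof (rule inj_onI, clarify)
      fix e f e' f'
      assume E: "e \<in> E" "f \<in> E" "e' \<in> E" "f' \<in> E" and "crosses e f" "crosses e' f'"
        and eq: "g e = g e'" "g f = g f'"
      then obtain x x' where x: "over e x" "over f x" "seg_y e x = seg_y f x" "e \<noteq> f"
          and x': "over e' x'" "over f' x'" "seg_y e' x' = seg_y f' x'" by (auto simp: crosses_def)
      have "g e \<noteq> g f" using line_edges_over_unique[OF P(2) g(2)[OF E(1)] _ x(1,2)] g(2)[OF E(2)] x(4) by auto
      then have "x = x'"
        using x(3) x'(3) line_through_two_unique[of "g e" x "g f" x']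
          seg_y_line_edges[OF g(2)[OF E(1)]] seg_y_line_edges[OF g(2)[OF E(2)]]
          seg_y_line_edges[OF g(2)[OF E(3)]] seg_y_line_edges[OF g(2)[OF E(4)]] eq by auto
      then have "e = e'" "f = f'"
        using line_edges_over_unique[OF P(2) g(2)[OF E(1)], of e' x] g(2)[OF E(3)] eq x x'
          line_edges_over_unique[OF P(2) g(2)[OF E(2)], of f' x] g(2)[OF E(4)] by auto
      then show "e = e' \<and> f = f'" by simp
    qed
  qed (use g L in auto)
  then have X: "real (card ?X) \<le> real (card L) ^ 2"
    by (simp add: card_cartesian_product power2_eq_square flip: of_nat_mult)
  show ?thesis
  proof (cases "6 * card P \<le> card E")
    case False
    then have "I \<le> 12 * real (card P)" using IE by linarith
    then show ?thesis by (simp add: I_def)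
  next
    case True
    define n e where "n = real (card P)" and "e = real (card E)"
    have e0: "e \<ge> 0" "n \<ge> 0" by (auto simp: e_def n_def)
    have k0: "real k > 0" using k by simp
    have "real (card L) \<le> 2 * e / real k" using LI IE k0 by (simp add: e_def field_simps)
    then have "real (card L) ^ 2 \<le> (2 * e / real k) ^ 2" by (rule power_mono) simp
    with X have "real (card ?X) \<le> (2 * e / real k) ^ 2" by linarith
    then have "72 * n ^ 2 * real (card ?X) \<le> 72 * n ^ 2 * (2 * e / real k) ^ 2" by (intro mult_left_mono) auto
    with crossing_lemma[OF D True] have "e ^ 3 \<le> 72 * n ^ 2 * (2 * e / real k) ^ 2"
      by (simp add: n_def e_def)
    also have "\<dots> = (288 * n ^ 2 / real k ^ 2) * e ^ 2" by (simp add: power_divide power_mult_distrib)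
    finally have *: "e * e ^ 2 \<le> (288 * n ^ 2 / real k ^ 2) * e ^ 2" by (simp add: eval_nat_numeral)
    have "e \<le> 288 * n ^ 2 / real k ^ 2"
    proof (cases "e = 0")
      case False
      then show ?thesis using * by (simp only: mult_le_cancel_right) (use e0 in auto)
    qed (use e0 in auto)
    then have "I \<le> 576 * n ^ 2 / real k ^ 2" using IE by (simp add: e_def)
    then show ?thesis by (simp add: I_def n_def)
  qed
qed

section \<open>Weighted sums over rich lines\<close>

lemma three_halves_power_le_sum_sqrt:
  "real m * sqrt (real m) \<le> 2 * (\<Sum>k=1..m. sqrt (real k))"
proof (induction m)
  case (Suc m)
  define a b where "a = sqrt (real m)" and "b = sqrt (real (Suc m))"
  have ab: "0 \<le> a" "a \<le> b" "b ^ 2 = a ^ 2 + 1" by (auto simp: a_def b_def)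
  have "a * a \<le> b * b" using ab by (intro mult_mono) auto
  moreover have "0 \<le> a * b" using ab by simp
  ultimately have "0 \<le> b * b + a * b - a * a" by linarith
  \<comment> \<open>Given \<open>b ^ 2 = a ^ 2 + 1\<close>, this is the increment bound
    \<open>b ^ 3 - a ^ 3 \<le> 2 * b\<close> in factored form.\<close>
  then have "0 \<le> (b - a) * (b * b + a * b - a * a)" using ab by (intro mult_nonneg_nonneg) auto
  then have "b ^ 3 \<le> a ^ 3 + 2 * b * (b ^ 2 - a ^ 2)" by (simp add: algebra_simps eval_nat_numeral)
  then have "b ^ 3 \<le> a ^ 3 + 2 * b" using ab(3) by simp
  moreover have "a ^ 3 \<le> 2 * (\<Sum>k=1..m. sqrt (real k))"
    using Suc.IH by (simp add: a_def eval_nat_numeral mult.commute)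
  ultimately have "b ^ 3 \<le> 2 * (\<Sum>k=1..Suc m. sqrt (real k))" by (simp add: b_def)
  moreover have "real (Suc m) * sqrt (real (Suc m)) = b ^ 2 * b" by (simp add: b_def)
  then have "real (Suc m) * sqrt (real (Suc m)) = b ^ 3" by (simp add: eval_nat_numeral)
  ultimately show ?case by linarith
qed simp

lemma sum_inverse_three_halves_le:
  "(\<Sum>k=1..N. sqrt (real k) / real k ^ 2) \<le> 3"
proof -
  \<comment> \<open>For k > 1 the term is at most 2 / sqrt (k - 1) - 2 / sqrt k. The subtracted
    \<open>2 / sqrt (real (Suc N))\<close> makes the induction telescope, with equality at
    \<open>N = 0\<close>.\<close>
  have "(\<Sum>k=1..Suc N. sqrt (real k) / real k ^ 2) \<le> 3 - 2 / sqrt (real (Suc N))" for N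
  proof (induction N)
    case (Suc N)
    define a b where "a = sqrt (real (Suc N))" and "b = sqrt (real (Suc (Suc N)))"
    have ab: "0 < a" "a \<le> b" "b ^ 2 = a ^ 2 + 1" by (auto simp: a_def b_def)
    then have b: "b > 0" by linarith
    have m: "real (Suc (Suc N)) = b ^ 2" by (simp add: b_def)
    have "(b - a) * (b + a) = 1" using ab(3) by (simp add: algebra_simps power2_eq_square)
    moreover have "(b - a) * (b + a) \<le> (b - a) * (2 * b)" using ab by (intro mult_left_mono) auto
    ultimately have "1 \<le> 2 * b * (b - a)" by (simp add: algebra_simps)
    then have "a * 1 \<le> a * (2 * b * (b - a))" using ab by (intro mult_left_mono) auto
    also have "\<dots> \<le> b * (2 * b * (b - a))" using ab b by (intro mult_right_mono) auto
    finally have "a \<le> 2 * b ^ 2 * (b - a)" by (simp add: power2_eq_square algebra_simps)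
    then have "a / (a * b ^ 3) \<le> 2 * b ^ 2 * (b - a) / (a * b ^ 3)" using ab b by (intro divide_right_mono) auto
    moreover have "a / (a * b ^ 3) = b / (b ^ 2) ^ 2" using ab(1) b by (simp add: divide_simps eval_nat_numeral)
    moreover have "2 * b ^ 2 * (b - a) / (a * b ^ 3) = 2 / a - 2 / b"
      using ab(1) b by (simp add: divide_simps) (simp add: eval_nat_numeral algebra_simps)
    ultimately have "b / (b ^ 2) ^ 2 \<le> 2 / a - 2 / b" by simp
    moreover have "(\<Sum>k=1..Suc (Suc N). sqrt (real k) / real k ^ 2) =
        (\<Sum>k=1..Suc N. sqrt (real k) / real k ^ 2) + b / (b ^ 2) ^ 2"
      using m by (simp add: b_def)
    ultimately show ?case using Suc.IH by (simp only: a_def[symmetric] b_def[symmetric])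
  qed simp
  then have "(\<Sum>k=1..Suc N. sqrt (real k) / real k ^ 2) \<le> 3" for N
    by (rule order_trans) simp
  then show ?thesis by (cases N) auto
qed

text \<open>In the weight of a line with m points, a factor m * sqrt m is replaced by twice the sum
  of sqrt k over k up to m. After exchanging the sums, the inner one counts incidences on k-rich
  lines, which is O(n^2 / k^2), and the series of sqrt k / k^2 converges. The bound on
  \<open>K\<close> keeps k in the range where the quadratic term of \<open>szemeredi_trotter\<close>
  dominates.\<close>

lemma sum_lines_weight_le:
  assumes P: "finite P" "inj_on fst P" and L: "finite L" and K: "K\<^sup>2 \<le> card P"
    and m: "\<And>l. l \<in> L \<Longrightarrow> 2 \<le> card (on_line P l) \<and> card (on_line P l) \<le> K"
  shows "(\<Sum>l\<in>L. real (card (on_line P l)) ^ 2 * sqrt (card (on_line P l))) \<le> 3456 * real (card P) ^ 2"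
proof -
  let ?m = "\<lambda>l. card (on_line P l)"
  let ?n = "real (card P)"
  have "(\<Sum>l\<in>L. real (?m l) ^ 2 * sqrt (?m l)) = (\<Sum>l\<in>L. real (?m l) * (real (?m l) * sqrt (?m l)))"
    by (simp add: power2_eq_square mult.assoc)
  also have "\<dots> \<le> (\<Sum>l\<in>L. real (?m l) * (2 * (\<Sum>k=1..?m l. sqrt (real k))))"
    by (intro sum_mono mult_left_mono three_halves_power_le_sum_sqrt) simp
  also have "\<dots> = (\<Sum>l\<in>L. \<Sum>k=1..K. if k \<le> ?m l then 2 * sqrt (real k) * real (?m l) else 0)"
  proof (intro sum.cong refl)
    fix l assume "l \<in> L"
    then have "{1..?m l} = {k\<in>{1..K}. k \<le> ?m l}" using m by fastforce
    then show "real (?m l) * (2 * (\<Sum>k=1..?m l. sqrt (real k))) =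
        (\<Sum>k=1..K. if k \<le> ?m l then 2 * sqrt (real k) * real (?m l) else 0)"
      by (simp add: sum.inter_filter[symmetric] sum_distrib_left sum_distrib_right mult_ac)
  qed
  also have "\<dots> = (\<Sum>k=1..K. \<Sum>l\<in>L. if k \<le> ?m l then 2 * sqrt (real k) * real (?m l) else 0)"
    by (rule sum.swap)
  also have "\<dots> = (\<Sum>k=1..K. 2 * sqrt (real k) * real (\<Sum>l\<in>{l\<in>L. k \<le> ?m l}. ?m l))"
    using L by (simp add: sum.inter_filter[symmetric] sum_distrib_left)
  also have "\<dots> \<le> (\<Sum>k=1..K. 2 * sqrt (real k) * (576 * ?n ^ 2 / real k ^ 2))"
  proof (intro sum_mono mult_left_mono)
    fix k assume k: "k \<in> {1..K}"
    show "real (\<Sum>l\<in>{l\<in>L. k \<le> ?m l}. ?m l) \<le> 576 * ?n ^ 2 / real k ^ 2"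
    proof (cases "{l\<in>L. k \<le> ?m l} = {}")
      case False
      \<comment> \<open>\<open>szemeredi_trotter\<close> needs a threshold of at least 2; for
        \<open>k = 1\<close> nothing changes, because all lines of \<open>L\<close> carry two
        points.\<close>
      define k' where "k' = max 2 k"
      from False m have "k' \<le> K" using k by (force simp: k'_def)
      then have "k'\<^sup>2 \<le> K\<^sup>2" by (intro power_mono) auto
      with K have "k'\<^sup>2 \<le> card P" by linarith
      then have k'n: "real k' ^ 2 \<le> ?n" by (metis of_nat_le_iff of_nat_power)
      have k'0: "real k' > 0" by (simp add: k'_def)
      have "12 * ?n * real k' ^ 2 \<le> 12 * ?n * ?n" using k'n by (intro mult_left_mono) auto
      also have "\<dots> \<le> 576 * ?n ^ 2" by (simp add: power2_eq_square)
      finally have 12: "12 * ?n \<le> 576 * ?n ^ 2 / real k' ^ 2" using k'0 by (simp add: field_simps)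
      have "real (\<Sum>l\<in>{l\<in>L. k \<le> ?m l}. ?m l) \<le> max (12 * ?n) (576 * ?n ^ 2 / real k' ^ 2)"
        by (rule szemeredi_trotter) (use P L m in \<open>auto simp: k'_def\<close>)
      also have "\<dots> = 576 * ?n ^ 2 / real k' ^ 2" using 12 by simp
      also have "\<dots> \<le> 576 * ?n ^ 2 / real k ^ 2"
        using k by (intro divide_left_mono power_mono mult_pos_pos zero_less_power) (auto simp: k'_def)
      finally show ?thesis .
    next
      case True
      then show ?thesis unfolding True by simp
    qed
  qed auto
  also have "\<dots> = 1152 * ?n ^ 2 * (\<Sum>k=1..K. sqrt (real k) / real k ^ 2)"
    by (simp add: sum_distrib_left mult_ac)
  also have "\<dots> \<le> 1152 * ?n ^ 2 * 3"
    by (intro mult_left_mono sum_inverse_three_halves_le) auto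
  finally show ?thesis by simp
qed

section \<open>Point sets in space\<close>

text \<open>With \<open>v = q - p\<close> its cardinality is the N(x) of the overview. The
  degenerate direction \<open>v = 0\<close> yields all of \<open>S\<close>.\<close>

definition fibre :: "(real ^ 3) set \<Rightarrow> real ^ 3 \<Rightarrow> real ^ 3 \<Rightarrow> (real ^ 3) set" where
  "fibre S v x = {y\<in>S. cross3 v (y - x) = 0}"

text \<open>The two coordinates are the functionals \<open>(1, t, t\<^sup>2)\<close> and its derivative, whose cross product
  \<open>(t\<^sup>2, -2t, 1)\<close> is orthogonal to a given nonzero vector for at most two values of \<open>t\<close>.\<close>

definition shadow :: "real \<Rightarrow> real ^ 3 \<Rightarrow> real \<times> real" where
  "shadow t v = (v $ 1 + t * v $ 2 + t\<^sup>2 * v $ 3, v $ 2 + 2 * t * v $ 3)"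

section \<open>Existence of a generic projection\<close>

lemma finite_quadratic_roots:
  fixes a b c :: real
  assumes "a \<noteq> 0 \<or> b \<noteq> 0 \<or> c \<noteq> 0"
  shows "finite {t. a + b * t + c * t\<^sup>2 = 0}"
proof -
  have "[:a, b, c:] \<noteq> 0" using assms by simp
  then have "finite {t. poly [:a, b, c:] t = 0}" by (rule poly_roots_finite)
  moreover have "{t. poly [:a, b, c:] t = 0} = {t. a + b * t + c * t\<^sup>2 = 0}"
    by (simp add: algebra_simps power2_eq_square)
  ultimately show ?thesis by simp
qed

lemma vec3_eq_0_iff: "v = 0 \<longleftrightarrow> v $ 1 = 0 \<and> v $ 2 = 0 \<and> v $ 3 = 0" for v :: "real ^ 3"
  by (simp add: vec_eq_iff forall_3)

lemma shadow_det:
  "fst (shadow t v) * snd (shadow t w) - snd (shadow t v) * fst (shadow t w) =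
    cross3 v w $ 3 - 2 * t * cross3 v w $ 2 + t\<^sup>2 * cross3 v w $ 1"
  by (simp add: shadow_def cross_components algebra_simps power2_eq_square)

lemma shadow_diff: "shadow t (v - w) = shadow t v - shadow t w"
  by (simp add: shadow_def algebra_simps)

text \<open>Each requirement can fail only at the roots of a nonzero quadratic in \<open>t\<close>:
  its coefficients are the coordinates of \<open>q - p\<close> for equal abscissae and, by
  \<open>shadow_det\<close>, those of the cross product up to constant factors for new
  collinearities. Finitely many \<open>t\<close> are excluded.\<close>

lemma generic_shadow:
  assumes "finite S"
  obtains t where "inj_on (fst \<circ> shadow t) S"
    "\<And>p q r. p \<in> S \<Longrightarrow> q \<in> S \<Longrightarrow> r \<in> S \<Longrightarrow>
       fst (shadow t (q - p)) * snd (shadow t (r - p)) = snd (shadow t (q - p)) * fst (shadow t (r - p)) \<Longrightarrow>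
       cross3 (q - p) (r - p) = 0"
proof -
  define B1 where "B1 p = {t. fst (shadow t p) = 0}" for p
  define B2 where "B2 w = {t. w $ 3 - 2 * t * w $ 2 + t\<^sup>2 * w $ 1 = 0}" for w :: "real ^ 3"
  have B1: "finite (B1 v)" if "v \<noteq> 0" for v
    using finite_quadratic_roots[of "v $ 1" "v $ 2" "v $ 3"] that
    by (simp add: B1_def shadow_def vec3_eq_0_iff mult.commute)
  have B2: "finite (B2 v)" if "v \<noteq> 0" for v
    using finite_quadratic_roots[of "v $ 3" "- 2 * v $ 2" "v $ 1"] that
    by (auto simp: B2_def vec3_eq_0_iff mult.commute mult.left_commute)
  define bad where "bad = (\<Union>(p, q)\<in>{(p, q)\<in>S \<times> S. p \<noteq> q}. B1 (q - p)) \<union>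
     (\<Union>(p, q, r)\<in>{(p, q, r)\<in>S \<times> S \<times> S. cross3 (q - p) (r - p) \<noteq> 0}. B2 (cross3 (q - p) (r - p)))"
  have f1: "finite {(p, q)\<in>S \<times> S. p \<noteq> q}"
    by (rule finite_subset[of _ "S \<times> S"]) (use assms in auto)
  have f2: "finite {(p, q, r)\<in>S \<times> S \<times> S. cross3 (q - p) (r - p) \<noteq> 0}"
    by (rule finite_subset[of _ "S \<times> S \<times> S"]) (use assms in auto)
  have "finite bad" unfolding bad_def
    by (intro finite_UnI finite_UN_I f1 f2) (auto intro: B1 B2)
  then obtain t where t: "t \<notin> bad" using ex_new_if_finite infinite_UNIV_char_0 by blast
  show ?thesis
  proof (rule that[of t])
    show "inj_on (fst \<circ> shadow t) S"
    proof (rule inj_onI, rule ccontr)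
      fix p q assume "p \<in> S" "q \<in> S" "(fst \<circ> shadow t) p = (fst \<circ> shadow t) q" "p \<noteq> q"
      then have "t \<in> B1 (q - p)" "(p, q) \<in> {(p, q)\<in>S \<times> S. p \<noteq> q}" by (auto simp: B1_def shadow_diff)
      then show False using t unfolding bad_def by blast
    qed
  next
    fix p q r assume S: "p \<in> S" "q \<in> S" "r \<in> S" and
      eq: "fst (shadow t (q - p)) * snd (shadow t (r - p)) = snd (shadow t (q - p)) * fst (shadow t (r - p))"
    show "cross3 (q - p) (r - p) = 0"
    proof (rule ccontr)
      assume "cross3 (q - p) (r - p) \<noteq> 0"
      moreover have "t \<in> B2 (cross3 (q - p) (r - p))"
        using eq by (simp add: B2_def shadow_det[symmetric])
      ultimately show False using t S unfolding bad_def by blast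
    qed
  qed
qed

text \<open>Group the pairs by the line they span. A line with m points receives at most m^2 ordered
  pairs of weight sqrt m each, which is the weight in \<open>sum_lines_weight_le\<close>.\<close>

lemma sum_pairs_sqrt_fibre_le:
  assumes S: "finite S" and K: "K\<^sup>2 \<le> card S"
  shows "(\<Sum>(p, q)\<in>{(p, q)\<in>S \<times> S. p \<noteq> q \<and> card (fibre S (q - p) p) \<le> K}. sqrt (card (fibre S (q - p) p)))
    \<le> 3456 * real (card S) ^ 2"
proof -
  obtain t where inj: "inj_on (fst \<circ> shadow t) S" and gen: "\<And>p q r. p \<in> S \<Longrightarrow> q \<in> S \<Longrightarrow> r \<in> S \<Longrightarrow>
       fst (shadow t (q - p)) * snd (shadow t (r - p)) = snd (shadow t (q - p)) * fst (shadow t (r - p)) \<Longrightarrow>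
       cross3 (q - p) (r - p) = 0"
    using generic_shadow[OF S] by metis
  have inj2: "inj_on (shadow t) S" using inj by (rule inj_on_imageI2)
  define P where "P = shadow t ` S"
  have P: "finite P" "inj_on fst P" "card P = card S"
    using S inj inj2 by (auto simp: P_def card_image intro: inj_on_imageI)
  define sl where "sl p q = snd (shadow t (q - p)) / fst (shadow t (q - p))" for p q
  define ln where "ln = (\<lambda>(p, q). (sl p q, snd (shadow t p) - sl p q * fst (shadow t p)))"
  define Z where "Z = {(p, q)\<in>S \<times> S. p \<noteq> q \<and> card (fibre S (q - p) p) \<le> K}"
  have finZ: "finite Z" by (rule finite_subset[of _ "S \<times> S"]) (use S in \<open>auto simp: Z_def\<close>)
  \<comment> \<open>Genericity: no point off the spatial line through \<open>p\<close> and
    \<open>q\<close> lands on its image, so richness is the same in space and in the plane.\<close>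
  have on: "on_line P (ln (p, q)) = shadow t ` fibre S (q - p) p" if "p \<in> S" "q \<in> S" "p \<noteq> q" for p q
  proof -
    have "(fst \<circ> shadow t) p \<noteq> (fst \<circ> shadow t) q" using inj that by (meson inj_onD)
    then have x: "fst (shadow t (q - p)) \<noteq> 0" by (simp add: shadow_diff)
    have "snd (shadow t y) = fst (ln (p, q)) * fst (shadow t y) + snd (ln (p, q)) \<longleftrightarrow> cross3 (q - p) (y - p) = 0"
      if y: "y \<in> S" for y
    proof -
      have "snd (shadow t y) = fst (ln (p, q)) * fst (shadow t y) + snd (ln (p, q)) \<longleftrightarrow>
          snd (shadow t (y - p)) = sl p q * fst (shadow t (y - p))"
        by (auto simp: ln_def shadow_diff algebra_simps)
      also have "\<dots> \<longleftrightarrow>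
          fst (shadow t (q - p)) * snd (shadow t (y - p)) = snd (shadow t (q - p)) * fst (shadow t (y - p))"
        using x by (auto simp: sl_def field_simps)
      also have "\<dots> \<longleftrightarrow> cross3 (q - p) (y - p) = 0"
        using gen[OF \<open>p \<in> S\<close> \<open>q \<in> S\<close> y] shadow_det[of t "q - p" "y - p"] by auto
      finally show ?thesis .
    qed
    then show ?thesis by (auto simp: on_line_def P_def fibre_def)
  qed
  have card_on: "card (on_line P (ln (p, q))) = card (fibre S (q - p) p)" if "p \<in> S" "q \<in> S" "p \<noteq> q" for p q
    unfolding on[OF that] by (rule card_image, rule inj_on_subset[OF inj2]) (auto simp: fibre_def)
  have fin_on: "finite (on_line P l)" for l using P by (simp add: on_line_def)
  have mem: "shadow t p \<in> on_line P (ln (p, q)) \<and> shadow t q \<in> on_line P (ln (p, q))"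
    if "p \<in> S" "q \<in> S" "p \<noteq> q" for p q
    unfolding on[OF that] using that by (auto simp: fibre_def)
  have "(\<Sum>(p, q)\<in>Z. sqrt (card (fibre S (q - p) p))) = (\<Sum>z\<in>Z. sqrt (card (on_line P (ln z))))"
    by (intro sum.cong) (auto simp: Z_def card_on)
  also have "\<dots> = (\<Sum>l\<in>ln ` Z. \<Sum>z\<in>{z\<in>Z. ln z = l}. sqrt (card (on_line P (ln z))))"
    by (rule sum.image_gen[OF finZ])
  also have "\<dots> = (\<Sum>l\<in>ln ` Z. real (card {z\<in>Z. ln z = l}) * sqrt (card (on_line P l)))"
    by (intro sum.cong refl) simp
  also have "\<dots> \<le> (\<Sum>l\<in>ln ` Z. real (card (on_line P l)) ^ 2 * sqrt (card (on_line P l)))"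
  proof (intro sum_mono mult_right_mono)
    fix l
    have "card {z\<in>Z. ln z = l} \<le> card (on_line P l \<times> on_line P l)"
    proof (rule card_inj_on_le[where f = "\<lambda>(p, q). (shadow t p, shadow t q)"])
      show "inj_on (\<lambda>(p, q). (shadow t p, shadow t q)) {z\<in>Z. ln z = l}"
        using inj2 by (auto simp: inj_on_def Z_def)
      show "(\<lambda>(p, q). (shadow t p, shadow t q)) ` {z\<in>Z. ln z = l} \<subseteq> on_line P l \<times> on_line P l"
        using mem by (auto simp: Z_def)
    qed (use fin_on in auto)
    then show "real (card {z\<in>Z. ln z = l}) \<le> real (card (on_line P l)) ^ 2"
      by (simp add: card_cartesian_product power2_eq_square flip: of_nat_mult)
  qed simp
  also have "\<dots> \<le> 3456 * real (card P) ^ 2"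
  proof (rule sum_lines_weight_le)
    fix l assume "l \<in> ln ` Z"
    then obtain p q where pq: "p \<in> S" "q \<in> S" "p \<noteq> q" "card (fibre S (q - p) p) \<le> K" "l = ln (p, q)"
      by (auto simp: Z_def)
    have "card {shadow t p, shadow t q} \<le> card (on_line P l)"
      by (rule card_mono) (use mem[OF pq(1-3)] pq fin_on in auto)
    moreover have "shadow t p \<noteq> shadow t q" using inj2 pq by (auto dest: inj_onD)
    ultimately show "2 \<le> card (on_line P l) \<and> card (on_line P l) \<le> K"
      using card_on[OF pq(1-3)] pq by simp
  qed (use P K finZ in auto)
  finally show ?thesis by (simp add: P(3) Z_def)
qed

section \<open>Edges and their completions\<close>

lemma parallel_iff: "cross3 v w = 0 \<longleftrightarrow> (\<exists>c. w = c *\<^sub>R v)" if "v \<noteq> 0"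
proof
  assume "cross3 v w = 0"
  then have "collinear {0, v, w}" by (simp add: cross_eq_0)
  then show "\<exists>c. w = c *\<^sub>R v" using that by (auto simp: collinear_lemma)
next
  assume "\<exists>c. w = c *\<^sub>R v"
  then show "cross3 v w = 0" by (auto simp: cross_mult_right)
qed

lemma parallel_cong:
  assumes "v \<noteq> 0" "w \<noteq> 0" "cross3 v w = 0"
  shows "cross3 v z = 0 \<longleftrightarrow> cross3 w z = 0"
proof -
  obtain c where c: "w = c *\<^sub>R v" using assms parallel_iff by blast
  with assms have "c \<noteq> 0" by auto
  then show ?thesis by (simp add: c cross_mult_left)
qed

lemma cross_diff_sym: "cross3 v (x - y) = 0 \<longleftrightarrow> cross3 v (y - x) = 0"
  by (simp add: Cross3.right_diff_distrib eq_commute[of "cross3 v x"])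

lemma fibre_cong: "v \<noteq> 0 \<Longrightarrow> w \<noteq> 0 \<Longrightarrow> cross3 v w = 0 \<Longrightarrow> fibre S v x = fibre S w x"
  using parallel_cong[of v w] unfolding fibre_def by blast

lemma finite_fibre: "finite S \<Longrightarrow> finite (fibre S v x)"
  by (simp add: fibre_def)

lemma fibre_self: "x \<in> S \<Longrightarrow> x \<in> fibre S v x"
  by (simp add: fibre_def)

lemma card_fibre_pos: "finite S \<Longrightarrow> x \<in> S \<Longrightarrow> 1 \<le> card (fibre S v x)"
  using fibre_self[of x S v] finite_fibre[of S v x] by (metis One_nat_def Suc_leI card_gt_0_iff empty_iff)

section \<open>Signed volumes\<close>

definition vol6 :: "real ^ 3 \<Rightarrow> real ^ 3 \<Rightarrow> real ^ 3 \<Rightarrow> real ^ 3 \<Rightarrow> real" where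
  "vol6 p q r s = (q - p) \<bullet> cross3 (r - p) (s - p)"

lemma vol6_swap: "vol6 p q s r = - vol6 p q r s"
  by (simp add: vol6_def cross3_def inner_vec_def sum_3 algebra_simps)

text \<open>With \<open>p\<close>, \<open>r\<close>, \<open>s\<close> fixed, the volume is linear in
  \<open>q - p\<close>. Along the direction \<open>w\<close> it is a multiple of one number, nonzero
  because \<open>c\<close> is, so the multiple is determined.\<close>

lemma vol6_determines_parallel_edge:
  assumes "vol6 p q r s = c" "vol6 p q' r s = c" "c \<noteq> 0"
    and w: "w \<noteq> 0" "cross3 (q - p) w = 0" "cross3 (q' - p) w = 0"
  shows "q = q'"
proof -
  have "cross3 w (q - p) = 0" "cross3 w (q' - p) = 0" using w cross_skew[of w] by auto
  then obtain a b where ab: "q - p = a *\<^sub>R w" "q' - p = b *\<^sub>R w"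
    using parallel_iff[OF w(1)] by blast
  have "a * (w \<bullet> cross3 (r - p) (s - p)) = b * (w \<bullet> cross3 (r - p) (s - p))"
       "a * (w \<bullet> cross3 (r - p) (s - p)) \<noteq> 0"
    using assms(1-3) ab by (auto simp: vol6_def)
  then have "a = b" by simp
  with ab have "q - p = q' - p" by simp
  then show ?thesis by simp
qed

text \<open>After projection along \<open>pq\<close>, the admissible \<open>s\<close> for a given \<open>r\<close> form a line, and distinct
  \<open>r\<close> give distinct lines, so two of them have at most one point in common. This needs the signed
  volume: with \<open>\<bar>vol6\<bar>\<close>, opposite points \<open>r\<close> would share their lines.\<close>

lemma common_completions_parallel:
  assumes 1: "vol6 p q r1 s1 = c" "vol6 p q r1 s2 = c"
    and 2: "vol6 p q r2 s1 = c" "vol6 p q r2 s2 = c"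
    and c: "c \<noteq> 0" and r: "cross3 (q - p) (r1 - r2) \<noteq> 0"
  shows "cross3 (q - p) (s1 - s2) = 0"
proof (rule ccontr)
  define v w a1 a2 where "v = q - p" and "w = s1 - s2" and "a1 = r1 - p" and "a2 = r2 - p"
  assume "cross3 (q - p) (s1 - s2) \<noteq> 0"
  then have vw: "cross3 v w \<noteq> 0" by (simp add: v_def w_def)
  have z: "a1 \<bullet> cross3 v w = 0" "a2 \<bullet> cross3 v w = 0"
    using 1 2 by (simp_all add: vol6_def v_def w_def a1_def a2_def cross3_def inner_vec_def sum_3 algebra_simps)
  \<comment> \<open>\<open>v\<close> and \<open>a1 - a2\<close> are orthogonal to \<open>m\<close>,
    so their cross product is \<open>k *\<^sub>R m\<close>. By \<open>e\<close>, either
    \<open>k = 0\<close>, which contradicts \<open>r\<close>, or \<open>s1 - p\<close> is orthogonal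
    to \<open>m\<close>, which would make the volume zero.\<close>
  define m where "m = cross3 v w"
  have e: "cross3 v (a1 - a2) \<bullet> (s1 - p) = 0"
    using 1(1) 2(1) by (simp add: vol6_def v_def a1_def a2_def cross3_def inner_vec_def sum_3 algebra_simps)
  have o: "v \<bullet> m = 0" "(a1 - a2) \<bullet> m = 0" 
    using z by (simp_all add: m_def dot_cross_self inner_diff_left)
  have "cross3 m (cross3 v (a1 - a2)) = 0"
    using Lagrange[of m v "a1 - a2"] o by (simp add: inner_commute)
  moreover have "m \<noteq> 0" using vw by (simp add: m_def)
  ultimately obtain k where k: "cross3 v (a1 - a2) = k *\<^sub>R m" using parallel_iff by blast
  have "m \<bullet> (s1 - p) \<noteq> 0"
  proof
    assume "m \<bullet> (s1 - p) = 0"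
    have "cross3 m (cross3 v a1) = 0"
      using Lagrange[of m v a1] o z by (simp add: inner_commute m_def)
    then obtain j where "cross3 v a1 = j *\<^sub>R m" using parallel_iff \<open>m \<noteq> 0\<close> by blast
    then have "cross3 v a1 \<bullet> (s1 - p) = 0" using \<open>m \<bullet> (s1 - p) = 0\<close> by simp
    moreover have "cross3 v a1 \<bullet> (s1 - p) = c"
      using 1(1) by (simp add: vol6_def v_def a1_def cross3_def inner_vec_def sum_3 algebra_simps)
    ultimately show False using c by simp
  qed
  with e k have "k = 0" by simp
  with k r show False by (simp add: v_def a1_def a2_def)
qed

section \<open>Counting the completions of one edge\<close>

lemma card_Times_filter:
  assumes "finite A" "finite B"
  shows "card {(a, b) \<in> A \<times> B. P a b} = (\<Sum>a\<in>A. card {b \<in> B. P a b})"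
proof -
  have "{(a, b) \<in> A \<times> B. P a b} = Sigma A (\<lambda>a. {b \<in> B. P a b})" by auto
  then show ?thesis using assms by (simp add: card_SigmaI)
qed

text \<open>Cauchy-Schwarz for the degrees \<open>card (d s)\<close> reduces the count to pairs
  \<open>r1\<close>, \<open>r2\<close> with a common \<open>s\<close>. Pairs on one line parallel to
  \<open>pq\<close> cost a factor \<open>K\<close>, since fibres in \<open>G\<close> have at most
  \<open>K\<close> points; the other pairs contribute at most \<open>A ^ 2\<close>.\<close>

lemma card_completions_le:
  fixes S :: "(real ^ 3) set" and K :: nat and p q :: "real ^ 3"
  assumes S: "finite S" and c: "c \<noteq> 0"
  defines "v \<equiv> q - p"
  defines "N \<equiv> \<lambda>x. card (fibre S v x)"
  defines "G \<equiv> {r\<in>S. N r \<le> K}"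
  shows "real (card {(s, r) \<in> S \<times> G. vol6 p q r s = c \<and> N s \<le> N r}) \<le>
    sqrt (card S) * (\<Sum>r\<in>G. sqrt (N r)) + real (card S) * real K"
proof -
  let ?n = "real (card S)"
  define d where "d s = {r\<in>G. vol6 p q r s = c \<and> N s \<le> N r}" for s
  have finG: "finite G" using S by (simp add: G_def)
  have find: "finite (d s)" for s using finG by (simp add: d_def)
  define A where "A = (\<Sum>r\<in>G. sqrt (N r))"
  define X where "X = (\<Sum>s\<in>S. real (card (d s)))"
  have A0: "A \<ge> 0" unfolding A_def by (rule sum_nonneg) simp
  have X0: "X \<ge> 0" by (simp add: X_def sum_nonneg)
  have CS: "X ^ 2 \<le> ?n * (\<Sum>s\<in>S. real (card (d s)) ^ 2)"
    using Cauchy_Schwarz_ineq_sum[of "\<lambda>_. 1" "\<lambda>s. real (card (d s))" S] by (simp add: X_def)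
  let ?par = "\<lambda>r1 r2. cross3 v (r1 - r2) = 0"
  have "(\<Sum>s\<in>S. real (card (d s)) ^ 2) =
      real (\<Sum>s\<in>S. card {(r1, r2) \<in> d s \<times> d s. ?par r1 r2}) +
      real (\<Sum>s\<in>S. card {(r1, r2) \<in> d s \<times> d s. \<not> ?par r1 r2})"
  proof -
    have "real (card (d s)) ^ 2 = real (card {(r1, r2) \<in> d s \<times> d s. ?par r1 r2}) +
        real (card {(r1, r2) \<in> d s \<times> d s. \<not> ?par r1 r2})" for s
    proof -
      have "d s \<times> d s = {(r1, r2) \<in> d s \<times> d s. ?par r1 r2} \<union> {(r1, r2) \<in> d s \<times> d s. \<not> ?par r1 r2}"
        by auto
      moreover have "card ({(r1, r2) \<in> d s \<times> d s. ?par r1 r2} \<union> {(r1, r2) \<in> d s \<times> d s. \<not> ?par r1 r2}) =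
          card {(r1, r2) \<in> d s \<times> d s. ?par r1 r2} + card {(r1, r2) \<in> d s \<times> d s. \<not> ?par r1 r2}"
        by (rule card_Un_disjoint; (rule finite_subset[of _ "d s \<times> d s"])?) (use find in auto)
      ultimately have "card (d s \<times> d s) = card {(r1, r2) \<in> d s \<times> d s. ?par r1 r2} +
          card {(r1, r2) \<in> d s \<times> d s. \<not> ?par r1 r2}" by (rule trans[OF arg_cong[of _ _ card]])
      then show ?thesis by (simp add: card_cartesian_product power2_eq_square flip: of_nat_mult of_nat_add)
    qed
    then show ?thesis by (simp add: sum.distrib)
  qed
  moreover have "real (\<Sum>s\<in>S. card {(r1, r2) \<in> d s \<times> d s. ?par r1 r2}) \<le> real K * X"
  proof -
    have "card {(r1, r2) \<in> d s \<times> d s. ?par r1 r2} \<le> K * card (d s)" for s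
    proof -
      have "card {(r1, r2) \<in> d s \<times> d s. ?par r1 r2} = (\<Sum>r1\<in>d s. card {r2 \<in> d s. ?par r1 r2})"
        by (rule card_Times_filter[OF find find])
      also have "\<dots> \<le> (\<Sum>r1\<in>d s. K)"
      proof (rule sum_mono)
        fix r1 assume "r1 \<in> d s"
        then have "N r1 \<le> K" by (simp add: d_def G_def)
        moreover have "card {r2 \<in> d s. ?par r1 r2} \<le> N r1" unfolding N_def
          by (rule card_mono[OF finite_fibre[OF S]])
             (auto simp: d_def G_def fibre_def cross_diff_sym[of v r1])
        ultimately show "card {r2 \<in> d s. ?par r1 r2} \<le> K" by linarith
      qed
      finally show ?thesis by (simp add: mult.commute)
    qed
    then have "real (card {(r1, r2) \<in> d s \<times> d s. ?par r1 r2}) \<le> real K * real (card (d s))" for s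
      by (simp only: of_nat_mult[symmetric] of_nat_le_iff)
    then show ?thesis unfolding X_def sum_distrib_left of_nat_sum by (rule sum_mono)
  qed
  \<comment> \<open>The common \<open>s\<close> of a non-parallel pair all lie in one fibre. The
    orientation \<open>N s \<le> N r\<close> bounds its size by both \<open>N r1\<close> and
    \<open>N r2\<close>, hence by their geometric mean, and the double sum factors.\<close>
  moreover have "real (\<Sum>s\<in>S. card {(r1, r2) \<in> d s \<times> d s. \<not> ?par r1 r2}) \<le> A ^ 2"
  proof -
    let ?E = "\<lambda>r1 r2. {s\<in>S. r1 \<in> d s \<and> r2 \<in> d s \<and> \<not> ?par r1 r2}"
    have "(\<Sum>s\<in>S. card {(r1, r2) \<in> d s \<times> d s. \<not> ?par r1 r2}) =
        (\<Sum>s\<in>S. card {z \<in> G \<times> G. fst z \<in> d s \<and> snd z \<in> d s \<and> \<not> ?par (fst z) (snd z)})"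
      by (intro sum.cong refl arg_cong[of _ _ card]) (auto simp: d_def)
    also have "\<dots> = card {(s, z) \<in> S \<times> (G \<times> G). fst z \<in> d s \<and> snd z \<in> d s \<and> \<not> ?par (fst z) (snd z)}"
      using card_Times_filter[of S "G \<times> G" "\<lambda>s z. fst z \<in> d s \<and> snd z \<in> d s \<and> \<not> ?par (fst z) (snd z)"] S finG
      by simp
    also have "\<dots> = card {(z, s) \<in> (G \<times> G) \<times> S. fst z \<in> d s \<and> snd z \<in> d s \<and> \<not> ?par (fst z) (snd z)}"
      by (rule bij_betw_same_card[of prod.swap]) (auto simp: bij_betw_def inj_on_def image_iff)
    also have "\<dots> = (\<Sum>z\<in>G \<times> G. card (?E (fst z) (snd z)))"
      using card_Times_filter[of "G \<times> G" S "\<lambda>z s. fst z \<in> d s \<and> snd z \<in> d s \<and> \<not> ?par (fst z) (snd z)"] S finG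
      by simp
    finally have "real (\<Sum>s\<in>S. card {(r1, r2) \<in> d s \<times> d s. \<not> ?par r1 r2}) =
        (\<Sum>z\<in>G \<times> G. real (card (?E (fst z) (snd z))))" by simp
    also have "\<dots> \<le> (\<Sum>z\<in>G \<times> G. sqrt (N (fst z)) * sqrt (N (snd z)))"
    proof (rule sum_mono)
      fix z
      show "real (card (?E (fst z) (snd z))) \<le> sqrt (N (fst z)) * sqrt (N (snd z))"
      proof (cases "?E (fst z) (snd z) = {}")
        case True
        then show ?thesis unfolding True by simp
      next
        case False
        then obtain s0 where s0: "s0 \<in> ?E (fst z) (snd z)" by blast
        have "?E (fst z) (snd z) \<subseteq> fibre S v s0"
        proof
          fix s assume s: "s \<in> ?E (fst z) (snd z)"
          have "cross3 (q - p) (s - s0) = 0"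
            by (rule common_completions_parallel[of p q "fst z" s c s0 "snd z"])
               (use s s0 c in \<open>auto simp: d_def v_def\<close>)
          then show "s \<in> fibre S v s0" using s by (simp add: fibre_def v_def)
        qed
        then have "card (?E (fst z) (snd z)) \<le> N s0"
          unfolding N_def by (rule card_mono[OF finite_fibre[OF S]])
        moreover have "N s0 \<le> N (fst z)" "N s0 \<le> N (snd z)" using s0 by (auto simp: d_def)
        ultimately have le: "card (?E (fst z) (snd z)) \<le> N (fst z)" "card (?E (fst z) (snd z)) \<le> N (snd z)"
          by auto
        let ?k = "real (card (?E (fst z) (snd z)))"
        have "sqrt ?k * sqrt ?k \<le> sqrt (N (fst z)) * sqrt (N (snd z))"
          using le by (intro mult_mono) auto
        then show ?thesis by simp
      qed
    qed
    also have "\<dots> = A ^ 2"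
      by (simp add: A_def power2_eq_square sum_product sum.cartesian_product case_prod_beta)
    finally show ?thesis .
  qed
  ultimately have "(\<Sum>s\<in>S. real (card (d s)) ^ 2) \<le> real K * X + A ^ 2" by linarith
  then have "?n * (\<Sum>s\<in>S. real (card (d s)) ^ 2) \<le> ?n * (real K * X + A ^ 2)"
    by (intro mult_left_mono) auto
  with CS have X2: "X ^ 2 \<le> ?n * (real K * X + A ^ 2)" by linarith
  \<comment> \<open>Solving the quadratic inequality \<open>X2\<close>: an \<open>X\<close> above
    the claimed bound, multiplied by that bound, already violates it.\<close>
  have "X \<le> sqrt ?n * A + ?n * real K"
  proof (rule ccontr)
    assume "\<not> ?thesis"
    then have gt: "sqrt ?n * A + ?n * real K < X" by simp
    have nn: "0 \<le> sqrt ?n * A" "0 \<le> ?n * real K" using A0 by auto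
    have Xpos: "0 < X" using gt nn by linarith
    have "sqrt ?n * A \<le> X" using gt nn(2) by linarith
    then have "(sqrt ?n * A) * (sqrt ?n * A) \<le> (sqrt ?n * A) * X"
      using nn(1) by (intro mult_left_mono)
    moreover have "(sqrt ?n * A) * (sqrt ?n * A) = ?n * A ^ 2" by (simp add: power2_eq_square algebra_simps)
    moreover have "(sqrt ?n * A + ?n * real K) * X < X * X" using gt Xpos by (intro mult_strict_right_mono)
    ultimately have "?n * A ^ 2 + ?n * real K * X < X ^ 2" by (simp add: power2_eq_square algebra_simps)
    with X2 show False by (simp add: algebra_simps)
  qed
  moreover have "real (card {(s, r) \<in> S \<times> G. vol6 p q r s = c \<and> N s \<le> N r}) = X"
    using card_Times_filter[OF S finG, of "\<lambda>s r. vol6 p q r s = c \<and> N s \<le> N r"] by (simp add: X_def d_def)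
  ultimately show ?thesis by (simp add: A_def)
qed

text \<open>Distinct admissible \<open>q\<close> give distinct directions, so their lines through
  \<open>x\<close> share only \<open>x\<close>. Without \<open>x\<close> the fibres are disjoint
  subsets of \<open>S\<close> with at least \<open>K\<close> points each.\<close>

lemma card_rich_edges_le:
  assumes S: "finite S" "x \<in> S" and c: "c \<noteq> 0"
  shows "card {q\<in>S. vol6 p q r s = c \<and> K < card (fibre S (q - p) x)} * K \<le> card S"
proof -
  define Q where "Q = {q\<in>S. vol6 p q r s = c \<and> K < card (fibre S (q - p) x)}"
  have "card Q * K = (\<Sum>q\<in>Q. K)" by simp
  also have "\<dots> \<le> (\<Sum>q\<in>Q. card (fibre S (q - p) x - {x}))"
    by (rule sum_mono) (use S in \<open>auto simp: Q_def fibre_self finite_fibre\<close>)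
  also have "\<dots> = card (\<Union>q\<in>Q. fibre S (q - p) x - {x})"
  proof (rule card_UN_disjoint[symmetric], goal_cases)
    case 3
    show ?case
    proof (intro ballI impI, rule ccontr)
      fix q q' assume q: "q \<in> Q" "q' \<in> Q" "q \<noteq> q'"
        and "(fibre S (q - p) x - {x}) \<inter> (fibre S (q' - p) x - {x}) \<noteq> {}"
      then obtain y where "y \<noteq> x" "cross3 (q - p) (y - x) = 0" "cross3 (q' - p) (y - x) = 0"
        by (auto simp: fibre_def)
      then show False
        using vol6_determines_parallel_edge[of p q r s c q' "y - x"] q c by (simp add: Q_def)
    qed
  qed (use S in \<open>auto simp: Q_def finite_fibre\<close>)
  also have "\<dots> \<le> card S" by (rule card_mono) (use S in \<open>auto simp: fibre_def\<close>)
  finally show ?thesis by (simp add: Q_def)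
qed

text \<open>A point \<open>r\<close> with a line no richer than that of \<open>p\<close> is charged
  to \<open>p\<close>, which costs \<open>n\<close> times the right-hand sum for n points. A richer
  line through \<open>r\<close> is charged to the pairs \<open>(r, r')\<close> on it instead, which
  costs twice as much again.\<close>

lemma sum_pairs_parallel_sqrt_fibre_le:
  fixes S :: "(real ^ 3) set" and K :: nat
  assumes S: "finite S"
  defines "N \<equiv> \<lambda>p q x. card (fibre S (q - p) x)"
  defines "Z \<equiv> {(p, q)\<in>S \<times> S. p \<noteq> q \<and> N p q p \<le> K}"
  shows "(\<Sum>(p, q)\<in>Z. \<Sum>r\<in>{r\<in>S. N p q r \<le> K}. sqrt (N p q r)) \<le>
    3 * real (card S) * (\<Sum>(p, q)\<in>Z. sqrt (N p q p))"
proof -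
  let ?n = "real (card S)"
  have finZ: "finite Z" by (rule finite_subset[of _ "S \<times> S"]) (use S in \<open>auto simp: Z_def\<close>)
  define cond where "cond = (\<lambda>z r r'. r' \<noteq> r \<and> cross3 (snd z - fst z) (r' - r) = 0 \<and>
    N (fst z) (snd z) (fst z) < N r r' r \<and> N r r' r \<le> K)"
  \<comment> \<open>The weight sqrt N of a line with N > 1 points is spread over its N - 1 points
    other than \<open>r\<close>; the factor 2 comes from N - 1 being at least N / 2.\<close>
  define f where "f r r' = 2 / sqrt (N r r' r)" for r r'
  have f0: "f r r' \<ge> 0" for r r' by (simp add: f_def)
  have pt: "(if N p q r \<le> K then sqrt (N p q r) else 0) \<le>
      sqrt (N p q p) + (\<Sum>r'\<in>S. if cond (p, q) r r' then f r r' else 0)"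
    if z: "(p, q) \<in> Z" and r: "r \<in> S" for p q r
  proof (cases "N p q p < N p q r \<and> N p q r \<le> K")
    case False
    have "0 \<le> (\<Sum>r'\<in>S. if cond (p, q) r r' then f r r' else 0)" by (intro sum_nonneg) (simp add: f0)
    moreover have "(if N p q r \<le> K then sqrt (N p q r) else 0) \<le> sqrt (N p q p)"
      using False by auto
    ultimately show ?thesis by linarith
  next
    case True
    have pq: "p \<in> S" "q \<in> S" "p \<noteq> q" using z by (auto simp: Z_def)
    have R: "N p q r \<ge> 2" using True card_fibre_pos[OF S pq(1), of "q - p"] by (simp add: N_def)
    have same: "N r r' r = N p q r" if "r' \<noteq> r" "cross3 (q - p) (r' - r) = 0" for r'
      using fibre_cong[of "q - p" "r' - r" S r] that pq by (simp add: N_def)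
    have set: "fibre S (q - p) r - {r} = {r'\<in>S. cond (p, q) r r'}"
      using True same by (auto simp: fibre_def cond_def)
    have "(\<Sum>r'\<in>S. if cond (p, q) r r' then f r r' else 0) = (\<Sum>r'\<in>{r'\<in>S. cond (p, q) r r'}. f r r')"
      using S by (simp add: sum.inter_filter)
    also have "\<dots> = (\<Sum>r'\<in>{r'\<in>S. cond (p, q) r r'}. 2 / sqrt (N p q r))"
      by (intro sum.cong refl) (simp add: f_def cond_def same)
    also have "\<dots> = real (N p q r - 1) * (2 / sqrt (N p q r))"
      unfolding set[symmetric] using fibre_self[OF r, of "q - p"] finite_fibre[OF S] by (simp add: N_def)
    also have "\<dots> \<ge> real (N p q r) / 2 * (2 / sqrt (N p q r))"
      using R by (intro mult_right_mono) auto
    finally have "real (N p q r) / sqrt (N p q r) \<le> (\<Sum>r'\<in>S. if cond (p, q) r r' then f r r' else 0)"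
      by simp
    then have "sqrt (N p q r) \<le> (\<Sum>r'\<in>S. if cond (p, q) r r' then f r r' else 0)"
      by (simp add: real_div_sqrt)
    then show ?thesis using True by (simp add: add_increasing)
  qed
  \<comment> \<open>For a given \<open>p\<close>, the admissible \<open>q\<close> lie on the
    parallel to \<open>r r'\<close> through \<open>p\<close>, which \<open>cond\<close> makes poorer
    than the line \<open>r r'\<close>.\<close>
  have count: "real (card {z\<in>Z. cond z r r'}) \<le> ?n * real (N r r' r)" for r r'
  proof -
    have "card {z\<in>Z. cond z r r'} \<le> card {(p, q)\<in>S \<times> S. (p, q) \<in> Z \<and> cond (p, q) r r'}"
      by (rule card_mono, rule finite_subset[of _ "S \<times> S"]) (use S in \<open>auto simp: Z_def\<close>)
    also have "\<dots> = (\<Sum>p\<in>S. card {q\<in>S. (p, q) \<in> Z \<and> cond (p, q) r r'})"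
      using card_Times_filter[OF S S, of "\<lambda>p q. (p, q) \<in> Z \<and> cond (p, q) r r'"] by simp
    also have "\<dots> \<le> (\<Sum>p\<in>S. N r r' r)"
    proof (rule sum_mono)
      fix p assume p: "p \<in> S"
      show "card {q\<in>S. (p, q) \<in> Z \<and> cond (p, q) r r'} \<le> N r r' r"
      proof (cases "{q\<in>S. (p, q) \<in> Z \<and> cond (p, q) r r'} = {}")
        case True
        then show ?thesis unfolding True by simp
      next
        case False
        then obtain q0 where q0: "q0 \<in> S" "(p, q0) \<in> Z" "cond (p, q0) r r'" by blast
        have "{q\<in>S. (p, q) \<in> Z \<and> cond (p, q) r r'} \<subseteq> fibre S (q0 - p) p"
        proof
          fix q assume q: "q \<in> {q\<in>S. (p, q) \<in> Z \<and> cond (p, q) r r'}"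
          have "cross3 (r' - r) (q - p) = 0"
            using q cross_skew[of "r' - r" "q - p"] by (simp add: cond_def)
          moreover have "cross3 (q0 - p) (r' - r) = 0" "r' - r \<noteq> 0" "q0 - p \<noteq> 0"
            using q0 by (auto simp: cond_def Z_def)
          ultimately have "cross3 (q0 - p) (q - p) = 0" using parallel_cong by blast
          then show "q \<in> fibre S (q0 - p) p" using q by (simp add: fibre_def)
        qed
        then have "card {q\<in>S. (p, q) \<in> Z \<and> cond (p, q) r r'} \<le> N p q0 p"
          unfolding N_def by (rule card_mono[OF finite_fibre[OF S]])
        then show ?thesis using q0 by (simp add: cond_def)
      qed
    qed
    also have "\<dots> = card S * N r r' r" by simp
    finally show ?thesis by (simp flip: of_nat_mult)
  qed
  have "(\<Sum>(p, q)\<in>Z. \<Sum>r\<in>{r\<in>S. N p q r \<le> K}. sqrt (N p q r)) =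
      (\<Sum>(p, q)\<in>Z. \<Sum>r\<in>S. if N p q r \<le> K then sqrt (N p q r) else 0)"
    using S by (intro sum.cong refl) (auto simp: sum.inter_filter)
  also have "\<dots> \<le> (\<Sum>(p, q)\<in>Z. \<Sum>r\<in>S. sqrt (N p q p) + (\<Sum>r'\<in>S. if cond (p, q) r r' then f r r' else 0))"
    by (intro sum_mono) (auto intro!: sum_mono pt)
  also have "\<dots> = ?n * (\<Sum>(p, q)\<in>Z. sqrt (N p q p)) + (\<Sum>z\<in>Z. \<Sum>r\<in>S. \<Sum>r'\<in>S. if cond z r r' then f r r' else 0)"
    by (simp add: sum.distrib sum_distrib_left case_prod_beta)
  also have "(\<Sum>z\<in>Z. \<Sum>r\<in>S. \<Sum>r'\<in>S. if cond z r r' then f r r' else 0) =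
      (\<Sum>z\<in>Z. \<Sum>y\<in>S \<times> S. if cond z (fst y) (snd y) then f (fst y) (snd y) else 0)"
    by (simp add: sum.cartesian_product case_prod_beta)
  also have "\<dots> = (\<Sum>y\<in>S \<times> S. \<Sum>z\<in>Z. if cond z (fst y) (snd y) then f (fst y) (snd y) else 0)"
    by (rule sum.swap)
  \<comment> \<open>\<open>cond\<close> forces \<open>r\<close> and \<open>r'\<close> to be distinct
    points on a line with at most \<open>K\<close> points, so the charged pairs lie again in
    \<open>Z\<close> and the sum closes on itself.\<close>
  also have "\<dots> = (\<Sum>y\<in>Z. \<Sum>z\<in>Z. if cond z (fst y) (snd y) then f (fst y) (snd y) else 0)"
  proof (rule sum.mono_neutral_right)
    show "\<forall>y\<in>S \<times> S - Z. (\<Sum>z\<in>Z. if cond z (fst y) (snd y) then f (fst y) (snd y) else 0) = 0"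
    proof
      fix y assume "y \<in> S \<times> S - Z"
      then have "\<not> cond z (fst y) (snd y)" for z by (cases y) (auto simp: cond_def Z_def)
      then show "(\<Sum>z\<in>Z. if cond z (fst y) (snd y) then f (fst y) (snd y) else 0) = 0" by simp
    qed
  qed (use S in \<open>auto simp: Z_def\<close>)
  also have "\<dots> = (\<Sum>y\<in>Z. real (card {z\<in>Z. cond z (fst y) (snd y)}) * f (fst y) (snd y))"
    using finZ by (intro sum.cong refl) (simp add: sum.inter_filter[symmetric])
  also have "\<dots> \<le> (\<Sum>y\<in>Z. ?n * real (N (fst y) (snd y) (fst y)) * f (fst y) (snd y))"
    by (intro sum_mono mult_right_mono count f0)
  also have "\<dots> = 2 * ?n * (\<Sum>(p, q)\<in>Z. sqrt (N p q p))"
  proof -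
    have "?n * real (N p q p) * f p q = 2 * ?n * sqrt (N p q p)" for p q
    proof -
      have "?n * real (N p q p) * f p q = 2 * ?n * (real (N p q p) / sqrt (N p q p))" by (simp add: f_def)
      then show ?thesis by (simp add: real_div_sqrt)
    qed
    then show ?thesis unfolding sum_distrib_left case_prod_beta by (intro sum.cong refl)
  qed
  finally show ?thesis by (simp add: algebra_simps)
qed

text \<open>Sum \<open>card_completions_le\<close> over all edges.
  \<open>sum_pairs_parallel_sqrt_fibre_le\<close> followed by \<open>sum_pairs_sqrt_fibre_le\<close>
  handles the first term, with 10368 = 3 * 3456; the second occurs for at most n^2 edges.\<close>

lemma card_poor_completions_le:
  assumes S: "finite S" and K: "K\<^sup>2 \<le> card S" and c: "c \<noteq> 0"
  defines "N \<equiv> \<lambda>p q x. card (fibre S (q - p) x)"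
  shows "real (card {((p, q), (s, r)) \<in> (S \<times> S) \<times> (S \<times> S). p \<noteq> q \<and> N p q p \<le> K \<and> N p q r \<le> K \<and>
      N p q s \<le> N p q r \<and> vol6 p q r s = c})
    \<le> 10368 * (sqrt (card S) * real (card S) ^ 3) + real K * real (card S) ^ 3"
proof -
  let ?n = "real (card S)"
  define Z where "Z = {(p, q)\<in>S \<times> S. p \<noteq> q \<and> N p q p \<le> K}"
  have finZ: "finite Z" by (rule finite_subset[of _ "S \<times> S"]) (use S in \<open>auto simp: Z_def\<close>)
  let ?D = "\<lambda>p q. {(s, r) \<in> S \<times> {r\<in>S. N p q r \<le> K}. vol6 p q r s = c \<and> N p q s \<le> N p q r}"
  have "{((p, q), (s, r)) \<in> (S \<times> S) \<times> (S \<times> S). p \<noteq> q \<and> N p q p \<le> K \<and> N p q r \<le> K \<and>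
      N p q s \<le> N p q r \<and> vol6 p q r s = c} = Sigma Z (\<lambda>(p, q). ?D p q)"
    by (auto simp: Z_def)
  moreover have "finite (?D p q)" for p q
    by (rule finite_subset[of _ "S \<times> S"]) (use S in auto)
  then have "card (Sigma Z (\<lambda>(p, q). ?D p q)) = (\<Sum>(p, q)\<in>Z. card (?D p q))"
    using finZ by (subst card_SigmaI) (auto simp: case_prod_beta)
  ultimately have "real (card {((p, q), (s, r)) \<in> (S \<times> S) \<times> (S \<times> S). p \<noteq> q \<and> N p q p \<le> K \<and> N p q r \<le> K \<and>
      N p q s \<le> N p q r \<and> vol6 p q r s = c}) = (\<Sum>(p, q)\<in>Z. real (card (?D p q)))"
    by (simp add: case_prod_beta)
  also have "\<dots> \<le> (\<Sum>(p, q)\<in>Z. sqrt ?n * (\<Sum>r\<in>{r\<in>S. N p q r \<le> K}. sqrt (N p q r)) + ?n * real K)"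
  proof (rule sum_mono)
    fix z :: "(real ^ 3) \<times> (real ^ 3)"
    obtain p q where z: "z = (p, q)" by (cases z)
    show "(case z of (p, q) \<Rightarrow> real (card (?D p q))) \<le>
        (case z of (p, q) \<Rightarrow> sqrt ?n * (\<Sum>r\<in>{r\<in>S. N p q r \<le> K}. sqrt (N p q r)) + ?n * real K)"
      unfolding z prod.case N_def using card_completions_le[OF S c, where p = p and q = q and K = K] by simp
  qed
  also have "\<dots> = sqrt ?n * (\<Sum>(p, q)\<in>Z. \<Sum>r\<in>{r\<in>S. N p q r \<le> K}. sqrt (N p q r)) + real (card Z) * (?n * real K)"
    by (simp add: sum.distrib sum_distrib_left case_prod_beta)
  also have "\<dots> \<le> sqrt ?n * (3 * ?n * (3456 * ?n ^ 2)) + ?n ^ 2 * (?n * real K)"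
  proof (intro add_mono mult_left_mono mult_right_mono)
    have "(\<Sum>(p, q)\<in>Z. \<Sum>r\<in>{r\<in>S. N p q r \<le> K}. sqrt (N p q r)) \<le> 3 * ?n * (\<Sum>(p, q)\<in>Z. sqrt (N p q p))"
      unfolding Z_def N_def by (rule sum_pairs_parallel_sqrt_fibre_le[OF S])
    also have "\<dots> \<le> 3 * ?n * (3456 * ?n ^ 2)"
      unfolding Z_def N_def by (intro mult_left_mono sum_pairs_sqrt_fibre_le[OF S K]) auto
    finally show "(\<Sum>(p, q)\<in>Z. \<Sum>r\<in>{r\<in>S. N p q r \<le> K}. sqrt (N p q r)) \<le> 3 * ?n * (3456 * ?n ^ 2)" .
    have "card Z \<le> card (S \<times> S)" by (rule card_mono) (use S in \<open>auto simp: Z_def\<close>)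
    then show "real (card Z) \<le> ?n ^ 2" by (simp add: card_cartesian_product power2_eq_square flip: of_nat_mult)
  qed auto
  finally show ?thesis by (simp add: eval_nat_numeral algebra_simps)
qed

section \<open>Counting tetrahedra\<close>

text \<open>\<open>g\<close> selects which of \<open>p\<close>, \<open>r\<close>, \<open>s\<close>
  lies on the rich line. For each of the n^3 triples, \<open>card_rich_edges_le\<close> leaves at
  most n / K choices of \<open>q\<close>.\<close>

lemma card_rich_tuples_le:
  assumes S: "finite S" and g: "\<And>p r s. p \<in> S \<Longrightarrow> r \<in> S \<Longrightarrow> s \<in> S \<Longrightarrow> g p r s \<in> S" and c: "c \<noteq> 0"
  shows "card {((p, q), (s, r)) \<in> (S \<times> S) \<times> (S \<times> S). vol6 p q r s = c \<and>
    K < card (fibre S (q - p) (g p r s))} * K \<le> card S ^ 4"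
proof -
  let ?Q = "\<lambda>(p, s, r) q. vol6 p q r s = c \<and> K < card (fibre S (q - p) (g p r s))"
  have "card {((p, q), (s, r)) \<in> (S \<times> S) \<times> (S \<times> S). vol6 p q r s = c \<and>
      K < card (fibre S (q - p) (g p r s))} = card {(y, q) \<in> (S \<times> S \<times> S) \<times> S. ?Q y q}"
    by (rule bij_betw_same_card[of "\<lambda>((p, q), (s, r)). ((p, s, r), q)"])
       (auto simp: bij_betw_def inj_on_def image_iff)
  also have "\<dots> = (\<Sum>y\<in>S \<times> S \<times> S. card {q\<in>S. ?Q y q})"
    by (rule card_Times_filter) (use S in auto)
  finally have "card {((p, q), (s, r)) \<in> (S \<times> S) \<times> (S \<times> S). vol6 p q r s = c \<and>
      K < card (fibre S (q - p) (g p r s))} * K = (\<Sum>y\<in>S \<times> S \<times> S. card {q\<in>S. ?Q y q} * K)"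
    by (simp add: sum_distrib_right)
  also have "\<dots> \<le> (\<Sum>y\<in>S \<times> S \<times> S. card S)"
    by (rule sum_mono) (use card_rich_edges_le[OF S _ c] g in \<open>auto\<close>)
  also have "\<dots> = card S ^ 4" by (simp add: card_cartesian_product eval_nat_numeral)
  finally show ?thesis .
qed

text \<open>The determinant formula for a simplex gives 6 or -6, and exchanging two vertices
  corrects the sign.\<close>

lemma unit_volume_tetrahedron_vertices:
  assumes "T \<in> unit_volume_tetrahedra S"
  obtains p q r s where "p \<in> S" "q \<in> S" "r \<in> S" "s \<in> S" "vol6 p q r s = 6" "T = convex hull {p, q, r, s}"
proof -
  from assms obtain C where C: "\<not> affine_dependent C" "int (card C) = 3 + 1" "T = convex hull C"
    and ext: "{x. x extreme_point_of T} \<subseteq> S" and vol: "measure lborel T = 1"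
    unfolding unit_volume_tetrahedra_def simplex_def by auto
  have CS: "C \<subseteq> S"
    using C ext extreme_point_of_convex_hull_affine_independent[OF C(1)] by auto
  have "card C = Suc (Suc (Suc (Suc 0)))" using C(2) by simp
  then obtain p q r s where pqrs: "C = {p, q, r, s}" "distinct [p, q, r, s]"
    by (auto simp: card_Suc_eq)
  define f where "f i = (if i = 1 then q else if i = 2 then r else s)" for i :: 3
  have f: "f 1 = q" "f 2 = r" "f 3 = s" by (simp_all add: f_def)
  have bij: "bij_betw f UNIV (C - {p})"
    unfolding bij_betw_def
  proof
    have "f ` UNIV = {q, r, s}" by (simp add: UNIV_3 f)
    moreover have "C - {p} = {q, r, s}" using pqrs by auto
    ultimately show "f ` UNIV = C - {p}" by simp
    have "card (f ` UNIV) = CARD(3)" unfolding \<open>f ` UNIV = {q, r, s}\<close> using pqrs(2) by simp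
    then show "inj f" by (intro eq_card_imp_inj_on) auto
  qed
  have "measure lborel T = \<bar>det (\<chi> i j. f j $ i - p $ i)\<bar> / fact CARD(3)"
    unfolding C(3) by (rule content_simplex) (use pqrs bij in auto)
  also have "det (\<chi> i j. f j $ i - p $ i) = vol6 p q r s"
    by (simp add: det_3 f vol6_def cross3_def inner_vec_def sum_3 algebra_simps)
  finally have "\<bar>vol6 p q r s\<bar> = 6" using vol by (simp add: fact_numeral)
  then consider "vol6 p q r s = 6" | "vol6 p q s r = 6" using vol6_swap[of p q s r] by linarith
  then show ?thesis
  proof cases
    case 1
    then show ?thesis using that[of p q r s] CS C(3) pqrs by auto
  next
    case 2
    then show ?thesis using that[of p q s r] CS C(3) pqrs by (auto simp: insert_commute)
  qed
qed

lemma card_unit_volume_tetrahedra_le: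
  assumes S: "finite S"
  shows "card (unit_volume_tetrahedra S) \<le> card {((p, q), (s, r)) \<in> (S \<times> S) \<times> (S \<times> S). vol6 p q r s = 6}"
proof (rule surj_card_le)
  show "finite {((p, q), (s, r)) \<in> (S \<times> S) \<times> (S \<times> S). vol6 p q r s = 6}"
    by (rule finite_subset[of _ "(S \<times> S) \<times> (S \<times> S)"]) (use S in auto)
  show "unit_volume_tetrahedra S \<subseteq>
      (\<lambda>((p, q), (s, r)). convex hull {p, q, r, s}) ` {((p, q), (s, r)) \<in> (S \<times> S) \<times> (S \<times> S). vol6 p q r s = 6}"
  proof
    fix T assume "T \<in> unit_volume_tetrahedra S"
    then obtain p q r s where "p \<in> S" "q \<in> S" "r \<in> S" "s \<in> S" "vol6 p q r s = 6" "T = convex hull {p, q, r, s}"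
      by (rule unit_volume_tetrahedron_vertices)
    then show "T \<in> (\<lambda>((p, q), (s, r)). convex hull {p, q, r, s}) `
        {((p, q), (s, r)) \<in> (S \<times> S) \<times> (S \<times> S). vol6 p q r s = 6}"
      by (intro image_eqI[of _ _ "((p, q), (s, r))"]) auto
  qed
qed

text \<open>\<open>R1\<close>, \<open>R2\<close>, \<open>R3\<close> collect the tuples with a rich
  line through \<open>p\<close>, \<open>r\<close>, \<open>s\<close>. Of the others, those with
  \<open>N s \<le> N r\<close> form \<open>W 6\<close>; in the opposite case exchanging
  \<open>r\<close> and \<open>s\<close> changes the volume to -6, which is why \<open>W'\<close> is
  an image of \<open>W (- 6)\<close>.\<close>

lemma card_vol6_tuples_le:
  assumes S: "finite S" and K: "K\<^sup>2 \<le> card S" "0 < K"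
  shows "real (card {((p, q), (s, r)) \<in> (S \<times> S) \<times> (S \<times> S). vol6 p q r s = 6}) \<le>
    3 * (real (card S) ^ 4 / real K) +
    2 * (10368 * (sqrt (card S) * real (card S) ^ 3) + real K * real (card S) ^ 3)"
proof -
  let ?U = "(S \<times> S) \<times> (S \<times> S)"
  let ?N = "\<lambda>p q x. card (fibre S (q - p) x)"
  define R where "R g = {((p, q), (s, r)) \<in> ?U. vol6 p q r s = 6 \<and> K < ?N p q (g p r s)}" for g
  define W where "W c = {((p, q), (s, r)) \<in> ?U. p \<noteq> q \<and> ?N p q p \<le> K \<and> ?N p q r \<le> K \<and>
      ?N p q s \<le> ?N p q r \<and> vol6 p q r s = c}" for c
  define W' where "W' = (\<lambda>(y, (s, r)). (y, (r, s))) ` W (- 6)"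
  define R1 R2 R3 where "R1 = R (\<lambda>p r s. p)" and "R2 = R (\<lambda>p r s. r)" and "R3 = R (\<lambda>p r s. s)"
  have fin: "finite A" if "A \<subseteq> ?U" for A using that S finite_subset by blast
  have finR: "finite (R g)" for g by (rule fin) (auto simp: R_def)
  have finW: "finite (W c)" for c by (rule fin) (auto simp: W_def)
  have "{((p, q), (s, r)) \<in> ?U. vol6 p q r s = 6} \<subseteq> R1 \<union> R2 \<union> R3 \<union> W 6 \<union> W'"
  proof (rule subsetI, rule ccontr)
    fix z assume z: "z \<in> {((p, q), (s, r)) \<in> ?U. vol6 p q r s = 6}" "z \<notin> R1 \<union> R2 \<union> R3 \<union> W 6 \<union> W'"
    obtain p q s r where "z = ((p, q), (s, r))" by (metis prod.exhaust)
    with z have m: "p \<in> S" "q \<in> S" "s \<in> S" "r \<in> S" "vol6 p q r s = 6" "((p, q), (s, r)) \<notin> W'"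
      "((p, q), (s, r)) \<notin> W 6" "((p, q), (s, r)) \<notin> R3" "((p, q), (s, r)) \<notin> R2"
      "((p, q), (s, r)) \<notin> R1" by auto
    have "p \<noteq> q" using m(5) by (auto simp: vol6_def)
    moreover have "?N p q p \<le> K" "?N p q r \<le> K" "?N p q s \<le> K"
      using m by (auto simp: R1_def R2_def R3_def R_def)
    moreover have "((p, q), (r, s)) \<notin> W (- 6)" using m(6) by (force simp: W'_def)
    then have "\<not> (p \<noteq> q \<and> ?N p q p \<le> K \<and> ?N p q s \<le> K \<and> ?N p q r \<le> ?N p q s)"
      using m vol6_swap[of p q s r] by (simp add: W_def)
    moreover have "\<not> (p \<noteq> q \<and> ?N p q p \<le> K \<and> ?N p q r \<le> K \<and> ?N p q s \<le> ?N p q r)"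
      using m by (simp add: W_def)
    ultimately show False by linarith
  qed
  moreover have finU: "finite (R1 \<union> R2 \<union> R3 \<union> W 6 \<union> W')"
    using finR finW by (simp add: R1_def R2_def R3_def W'_def)
  ultimately have "card {((p, q), (s, r)) \<in> ?U. vol6 p q r s = 6} \<le> card (R1 \<union> R2 \<union> R3 \<union> W 6 \<union> W')"
    by (intro card_mono)
  also have "\<dots> \<le> card R1 + card R2 + card R3 + card (W 6) + card W'"
    by (intro order_trans[OF card_Un_le] add_mono order_refl)
  finally have "real (card {((p, q), (s, r)) \<in> ?U. vol6 p q r s = 6}) \<le>
      real (card R1) + real (card R2) + real (card R3) + real (card (W 6)) + real (card W')"
    by linarith
  moreover have "real (card (R g)) \<le> real (card S) ^ 4 / real K"
    if "\<And>p r s. p \<in> S \<Longrightarrow> r \<in> S \<Longrightarrow> s \<in> S \<Longrightarrow> g p r s \<in> S" for g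
  proof -
    have "card (R g) * K \<le> card S ^ 4"
      unfolding R_def by (rule card_rich_tuples_le[OF S]) (use that in auto)
    then have "real (card (R g)) * real K \<le> real (card S) ^ 4"
      by (metis of_nat_le_iff of_nat_mult of_nat_power)
    then show ?thesis using K(2) by (simp add: field_simps)
  qed
  then have "real (card R1) \<le> real (card S) ^ 4 / real K" "real (card R2) \<le> real (card S) ^ 4 / real K"
      "real (card R3) \<le> real (card S) ^ 4 / real K"
    by (simp_all add: R1_def R2_def R3_def)
  moreover have "real (card (W c)) \<le>
      10368 * (sqrt (card S) * real (card S) ^ 3) + real K * real (card S) ^ 3" if "c \<noteq> 0" for c
    unfolding W_def by (rule card_poor_completions_le[OF S K(1) that])
  from this[of 6] this[of "- 6"]
  have "real (card (W 6)) \<le> 10368 * (sqrt (card S) * real (card S) ^ 3) + real K * real (card S) ^ 3"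
    "real (card (W (- 6))) \<le> 10368 * (sqrt (card S) * real (card S) ^ 3) + real K * real (card S) ^ 3"
    by simp_all
  moreover have "real (card W') \<le> real (card (W (- 6)))"
    unfolding W'_def of_nat_le_iff by (rule card_image_le[OF finW])
  moreover have "t \<le> 3 * a + 2 * b"
    if "t \<le> r1 + r2 + r3 + w1 + w2" "r1 \<le> a" "r2 \<le> a" "r3 \<le> a" "w1 \<le> b" "w3 \<le> b" "w2 \<le> w3"
    for t r1 r2 r3 w1 w2 w3 a b :: real
    using that by linarith
  ultimately show ?thesis by blast
qed

theorem theorem5:
  shows "\<exists>C::real. \<forall>(n::nat) (S :: (real ^ 3) set).
           finite S \<and> card S = n \<longrightarrow>
           real (card (unit_volume_tetrahedra S)) \<le> C * real n powr (7 / 2)"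
proof (intro exI allI impI)
  fix n :: nat and S :: "(real ^ 3) set"
  assume "finite S \<and> card S = n"
  then have S: "finite S" "card S = n" by auto
  let ?T = "{((p, q), (s, r)) \<in> (S \<times> S) \<times> (S \<times> S). vol6 p q r s = 6}"
  \<comment> \<open>The constant is 3 * 2 + 2 * (10368 + 1).\<close>
  show "real (card (unit_volume_tetrahedra S)) \<le> 20744 * real n powr (7 / 2)"
  proof (cases "n = 0")
    case True
    then have "S = {}" using S by simp
    then have "?T = {}" by auto
    then have "card ?T = 0" by (simp only: card.empty)
    then have "card (unit_volume_tetrahedra S) = 0"
      using card_unit_volume_tetrahedra_le[OF S(1)] by linarith
    then show ?thesis by simp
  next
    case False
    \<comment> \<open>This \<open>K\<close> balances n^4 / K against K * n^3. Rounding down costs at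
      most a factor 2, as \<open>u < K + 1\<close> and \<open>K\<close> is positive.\<close>
    define u K where "u = sqrt (real n)" and "K = nat \<lfloor>u\<rfloor>"
    have u: "1 \<le> u" "real n = u ^ 2" using False by (auto simp: u_def)
    have K: "real K \<le> u" "u < real K + 1" using u by (auto simp: K_def)
    have K0: "0 < K" using K u by linarith
    have "real K ^ 2 \<le> real n" unfolding u(2) using K by (intro power_mono) auto
    then have Kn: "K\<^sup>2 \<le> card S" unfolding S(2) by (metis of_nat_le_iff of_nat_power)
    have "real (card (unit_volume_tetrahedra S)) \<le> real (card ?T)"
      using card_unit_volume_tetrahedra_le[OF S(1)] by linarith
    also have "\<dots> \<le> 3 * (real n ^ 4 / real K) + 2 * (10368 * (u * real n ^ 3) + real K * real n ^ 3)"
      using card_vol6_tuples_le[OF S(1) Kn K0] by (simp add: S(2) u_def)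
    also have "\<dots> \<le> 3 * (2 * u ^ 7) + 2 * (10368 * u ^ 7 + u ^ 7)"
    proof -
      have n: "real n ^ 3 = u ^ 6" "real n ^ 4 = u ^ 7 * u" unfolding u(2)
        by (simp_all flip: power_mult power_Suc2)
      have "u \<le> 2 * real K" using K K0 by linarith
      then have "u ^ 7 * u \<le> u ^ 7 * (2 * real K)" using u by (intro mult_left_mono) auto
      then have "u ^ 7 * u / real K \<le> 2 * u ^ 7" using K0 by (simp add: field_simps)
      moreover have u7: "u * u ^ 6 = u ^ 7" by (simp flip: power_Suc)
      moreover have "real K * u ^ 6 \<le> u * u ^ 6" using K u by (intro mult_right_mono) auto
      ultimately show ?thesis unfolding n u7
        by (intro add_mono mult_left_mono order_refl) auto
    qed
    also have "\<dots> = 20744 * u ^ 7" by simp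
    also have "u ^ 7 = real n powr (7 / 2)"
      using False by (simp add: u_def powr_half_sqrt[symmetric] powr_power)
    finally show ?thesis .
  qed
qed

end
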